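(* For the potential $Q\equiv0$ on $\mathbf{T}$ there exists $\delta>0$ such that $LSI((1+\delta)/4)$ is satisfied, i.e. for every smooth probability measure $\mu$ on $\mathbf{T}$, $$E_0(\mu)-E_0(\mu_0)\le\frac{1}{1+\delta}\,I_0(\mu),$$ where $E_0,\mu_0,I_0$ denote $E_Q,\mu_Q,I_Q$ for $Q\equiv0$ (so $\mu_0=\alpha$).
   Context: $\mathbf{T}$ is the unit circle in $\mathbb{C}$ and $\alpha$ is the normalized (probability) Haar measure on $\mathbf{T}$. A measure on $\mathbf{T}$ is called smooth if it has a smooth density with respect to $\alpha$. For a differentiable function $\phi$ on $\mathbf{T}$, $\phi'(z)=\frac{d}{dt}\big|_{t=0}\phi(ze^{it})$. For a continuous $Q:\mathbf{T}\to\mathbb{R}$ (a potential) and a probability measure $\mu$ on $\mathbf{T}$, $E_Q(\mu)=\int Q\,d\mu-\iint\log|x-y|\,\mu(dx)\mu(dy)$; $\mu_Q$ denotes the (unique) minimizer of $E_Q$ over probability measures on $\mathbf{T}$. For a smooth probability measure $\mu$ on $\mathbf{T}$, with density $m$ with respect to $\alpha$, define $H\mu:\mathbf{T}\to\mathbb{R}$ by the principal value integral $H\mu(e^{ix})=\mathrm{p.v.}\int\cot\big(\frac{x-y}{2}\big)\,m(e^{iy})\,\frac{dy}{2\pi}$ over an interval of length $2\pi$, and for a $C^1$ potential $Q$, $I_Q(\mu)=\int(H\mu-Q')^{2}\,d\mu-\big(\int Q'\,d\mu\big)^{2}$. For $\rho>0$, $Q$ satisfies $LSI(\rho)$ if $E_Q(\mu)-E_Q(\mu_Q)\le\frac{1}{4\rho}I_Q(\mu)$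 for every smooth probability measure $\mu$ on $\mathbf{T}$. *)

theory Defs
  imports "HOL-Probability.Probability"
begin

abbreviation unit_circle :: "complex set"
  where "unit_circle \<equiv> sphere 0 1"

definition circle_haar :: "complex measure"
  where "circle_haar =
    distr (uniform_measure lborel {-pi..pi}) (restrict_space borel unit_circle) cis"

definition circle_prob_measure :: "complex measure \<Rightarrow> bool"
  where "circle_prob_measure \<mu> \<longleftrightarrow>
    prob_space \<mu> \<and> sets \<mu> = sets (restrict_space borel unit_circle)"

definition circle_deriv :: "(complex \<Rightarrow> real) \<Rightarrow> complex \<Rightarrow> real"
  where "circle_deriv \<phi> z = deriv (\<lambda>t. \<phi> (z * cis t)) 0"

text \<open>Smoothness (infinite differentiability) on the circle, expressed in the angular
  coordinate.\<close>

definition smooth_on_circle :: "(complex \<Rightarrow> real) \<Rightarrow> bool"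
  where "smooth_on_circle m \<longleftrightarrow>
    (\<forall>n t. (deriv ^^ n) (\<lambda>x. m (cis x)) field_differentiable (at t))"

text \<open>Nonnegativity is required explicitly, since \<^const>\<open>ennreal\<close> truncates negative
  values to 0.\<close>

definition is_smooth_density :: "complex measure \<Rightarrow> (complex \<Rightarrow> real) \<Rightarrow> bool"
  where "is_smooth_density \<mu> m \<longleftrightarrow>
    smooth_on_circle m \<and> (\<forall>z\<in>unit_circle. 0 \<le> m z) \<and>
    \<mu> = density circle_haar (\<lambda>z. ennreal (m z))"

definition smooth_prob_measure :: "complex measure \<Rightarrow> bool"
  where "smooth_prob_measure \<mu> \<longleftrightarrow>
    circle_prob_measure \<mu> \<and> (\<exists>m. is_smooth_density \<mu> m)"

text \<open>A smooth density is uniquely determined on the circle, and only its values there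
  are used below.\<close>

definition smooth_density :: "complex measure \<Rightarrow> complex \<Rightarrow> real"
  where "smooth_density \<mu> = (SOME m. is_smooth_density \<mu> m)"

text \<open>The Lebesgue integral of an extended real function, as the difference of the
  integrals of its positive and negative parts (\<^const>\<open>e2ennreal\<close> maps negative
  values to 0). It is used only for functions whose positive part has a finite integral.\<close>

definition ereal_integral :: "'a measure \<Rightarrow> ('a \<Rightarrow> ereal) \<Rightarrow> ereal"
  where "ereal_integral M f =
    enn2ereal (\<integral>\<^sup>+x. e2ennreal (f x) \<partial>M) - enn2ereal (\<integral>\<^sup>+x. e2ennreal (- f x) \<partial>M)"

text \<open>The kernel takes the value \<open>-\<infinity>\<close> on the diagonal, whereas \<open>ln 0 = 0\<close> in HOL;
  hence the case distinction. The energy of a probability measure with atoms is \<open>\<infinity>\<close>.\<close>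

definition log_dist :: "complex \<Rightarrow> complex \<Rightarrow> ereal"
  where "log_dist x y = (if x = y then -\<infinity> else ereal (ln (cmod (x - y))))"

definition energy :: "(complex \<Rightarrow> real) \<Rightarrow> complex measure \<Rightarrow> ereal"
  where "energy Q \<mu> =
    ereal (\<integral>x. Q x \<partial>\<mu>) - ereal_integral (\<mu> \<Otimes>\<^sub>M \<mu>) (\<lambda>(x, y). log_dist x y)"

definition equilibrium_measure :: "(complex \<Rightarrow> real) \<Rightarrow> complex measure"
  where "equilibrium_measure Q = arg_min (energy Q) circle_prob_measure"

text \<open>The principal value is taken over the interval of length \<open>2 * pi\<close> centred at an
  argument \<open>x\<close> of the point, with a symmetric neighbourhood of \<open>x\<close> removed.\<close>

definition circle_hilbert :: "complex measure \<Rightarrow> complex \<Rightarrow> real"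
  where "circle_hilbert \<mu> z = (let x = Arg z in
    Lim (at_right 0) (\<lambda>\<epsilon>.
      LINT y:{y. \<epsilon> < \<bar>x - y\<bar> \<and> \<bar>x - y\<bar> \<le> pi}|lborel.
        cot ((x - y) / 2) * smooth_density \<mu> (cis y) / (2 * pi)))"

definition fisher_information :: "(complex \<Rightarrow> real) \<Rightarrow> complex measure \<Rightarrow> real"
  where "fisher_information Q \<mu> =
    (\<integral>z. (circle_hilbert \<mu> z - circle_deriv Q z)\<^sup>2 \<partial>\<mu>) - (\<integral>z. circle_deriv Q z \<partial>\<mu>)\<^sup>2"

definition LSI :: "real \<Rightarrow> (complex \<Rightarrow> real) \<Rightarrow> bool"
  where "LSI \<rho> Q \<longleftrightarrow>
    (\<forall>\<mu>. smooth_prob_measure \<mu> \<longrightarrow>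
      energy Q \<mu> - energy Q (equilibrium_measure Q)
        \<le> ereal (1 / (4 * \<rho>) * fisher_information Q \<mu>))"

end

theory Submission
  imports Defs "HOL-Complex_Analysis.Complex_Analysis"
begin

text \<open>Let \<open>m\<close> be the density of \<open>\<mu>\<close> and \<open>c k\<close> the \<open>k\<close>-th moment of \<open>\<mu>\<close>. Expanding the logarithm
  gives \<open>E \<mu> = (\<Sum>k\<ge>1. \<bar>c k\<bar>\<^sup>2 / k)\<close>. So \<open>E\<close> is nonnegative, and by Bessel's inequality \<open>E \<mu>\<close> is at most
  half the integral of \<open>(m - 1)\<^sup>2\<close>. On the other hand \<open>m + \<i> H\<mu>\<close> is the boundary value of
  a holomorphic function on the disc with value \<open>1\<close> at \<open>0\<close>; the mean value property of its cube
  turns the integral of \<open>(H\<mu>)\<^sup>2 m\<close> into one third of that of \<open>m\<^sup>3 - 1\<close>. The two sides are then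
  compared through \<open>m (m - 1)\<^sup>2 \<ge> 0\<close>, which yields \<open>\<delta> = 1 / 3\<close>.\<close>

subsection \<open>Averages over the circle in the angular coordinate\<close>

text \<open>The Hilbert transform exists only as a principal value, so the holomorphic function with
  boundary value \<open>m + i H\<close> cannot be written down on the circle itself. It is built
  inside the disc with the Herglotz kernel, and circles of radius \<open>r < 1\<close> are pushed to
  the boundary by dominated convergence. The majorant comes from a Lipschitz bound on
  \<open>m\<close>, which cancels the \<open>1 / t\<close> singularity of the kernel uniformly in
  \<open>r\<close>. The logarithm is treated in the same spirit: for \<open>r < 1\<close> its
  expansion may be integrated term by term, and the passage to \<open>r = 1\<close> is split into
  two one-sided estimates. A pointwise comparison of kernels gives nonnegativity for every
  probability measure, even of infinite energy; Fatou's lemma gives the upper bound. Nonnegativity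
  also controls the minimizer: \<open>equilibrium_measure\<close> is given by choice, and it is
  known to be a probability measure once Haar measure is seen to attain the minimum.\<close>

abbreviation angle_measure :: "real measure"
  where "angle_measure \<equiv> uniform_measure lborel {-pi..pi}"

lemma prob_space_angle_measure: "prob_space angle_measure"
  by (rule prob_space_uniform_measure) auto

lemma angle_measure_eq_density:
  "angle_measure = density lborel (\<lambda>x. ennreal (indicator {-pi..pi} x / (2 * pi)))"
  unfolding uniform_measure_def
  by (intro density_cong AE_I2)
     (auto simp: indicator_def divide_ennreal ennreal_1[symmetric] simp del: ennreal_1)

lemma integral_angle_measure:
  fixes f :: "real \<Rightarrow> 'b::{banach,second_countable_topology}"
  assumes "f \<in> borel_measurable borel"
  shows "integral\<^sup>L angle_measure f = (LINT x:{-pi..pi}|lborel. f x) /\<^sub>R (2 * pi)"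
proof -
  have "integral\<^sup>L angle_measure f =
      (LINT x|lborel. (indicator {-pi..pi} x / (2 * pi)) *\<^sub>R f x)"
    unfolding angle_measure_eq_density using assms by (intro integral_density) auto
  also have "\<dots> = (LINT x|lborel. (1 / (2 * pi)) *\<^sub>R (indicator {-pi..pi} x *\<^sub>R f x))"
    by (intro Bochner_Integration.integral_cong) auto
  also have "\<dots> = (1 / (2 * pi)) *\<^sub>R (LINT x|lborel. indicator {-pi..pi} x *\<^sub>R f x)"
    by (rule integral_scaleR_right)
  finally show ?thesis
    by (simp only: set_lebesgue_integral_def inverse_eq_divide)
qed

text \<open>The removed null set contains \<open>0\<close>, where the kernels are singular, and
  \<open>-pi\<close>, where \<open>Arg (cis x)\<close> differs from \<open>x\<close>.\<close>

lemma AE_angle_measure: "AE t in angle_measure. t \<in> {-pi<..<pi} - {0}"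
proof -
  have "AE t in lborel. t \<noteq> -pi \<and> t \<noteq> pi \<and> t \<noteq> (0::real)"
    by (intro AE_conjI AE_lborel_singleton)
  then have "AE t in lborel. t \<in> {-pi..pi} \<longrightarrow> t \<in> {-pi<..<pi} - {0}"
    by eventually_elim auto
  then show ?thesis
    by (intro AE_uniform_measureI) auto
qed

lemma integral_angle_measure_continuous:
  fixes f :: "real \<Rightarrow> 'b::euclidean_space"
  assumes "continuous_on UNIV f"
  shows "integral\<^sup>L angle_measure f = integral {-pi..pi} f /\<^sub>R (2 * pi)"
proof -
  have "(LINT x:{-pi..pi}|lborel. f x) = integral {-pi..pi} f"
    using assms by (intro set_borel_integral_eq_integral borel_integrable_atLeastAtMost')
      (auto intro: continuous_on_subset)
  then show ?thesis
    using assms by (simp add: integral_angle_measure borel_measurable_continuous_onI)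
qed

lemma integrable_angle_measure:
  fixes f :: "real \<Rightarrow> 'b::{banach,second_countable_topology}"
  assumes "f \<in> borel_measurable borel" "\<And>x. \<bar>x\<bar> \<le> pi \<Longrightarrow> norm (f x) \<le> B"
  shows "integrable angle_measure f"
proof -
  interpret prob_space angle_measure by (rule prob_space_angle_measure)
  show ?thesis
    using assms by (intro integrable_const_bound[where B = B] AE_uniform_measureI) auto
qed

lemma integrable_angle_measure_continuous:
  fixes f :: "real \<Rightarrow> 'b::euclidean_space"
  assumes "continuous_on UNIV f"
  shows "integrable angle_measure f"
proof -
  have "compact (f ` {-pi..pi})"
    using assms by (intro compact_continuous_image) (auto intro: continuous_on_subset)
  then obtain B where "\<And>x. x \<in> {-pi..pi} \<Longrightarrow> norm (f x) \<le> B"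
    by (force simp: bounded_iff dest: compact_imp_bounded)
  then show ?thesis
    using assms by (intro integrable_angle_measure[where B = B] borel_measurable_continuous_onI)
      (simp_all add: abs_le_iff)
qed

lemma norm_integral_angle_measure_le:
  fixes f :: "real \<Rightarrow> 'b::{banach,second_countable_topology}"
  assumes [measurable]: "f \<in> borel_measurable borel" and B: "\<And>x. \<bar>x\<bar> \<le> pi \<Longrightarrow> norm (f x) \<le> B"
  shows "norm (integral\<^sup>L angle_measure f) \<le> B"
proof -
  interpret prob_space angle_measure by (rule prob_space_angle_measure)
  have "integrable angle_measure f"
    by (rule integrable_angle_measure) (use B in auto)
  have "norm (integral\<^sup>L angle_measure f) \<le> (\<integral>x. norm (f x) \<partial>angle_measure)"
    by simp
  also have "\<dots> \<le> (\<integral>x. B \<partial>angle_measure)"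
    using B \<open>integrable angle_measure f\<close>
    by (intro integral_mono_AE integrable_norm AE_uniform_measureI) auto
  finally show ?thesis by (simp add: prob_space)
qed

text \<open>For \<open>a \<le> b\<close>, splitting \<open>[a, b + p]\<close> at \<open>b\<close>
  and at \<open>a + p\<close> leaves remainders over \<open>[a, b]\<close> and its translate
  \<open>[a + p, b + p]\<close>, which agree by periodicity. For \<open>p \<le> 0\<close> all
  intervals are empty or single points.\<close>

lemma integral_period_shift:
  fixes f :: "real \<Rightarrow> 'b::euclidean_space"
  assumes cont: "continuous_on UNIV f" and per: "\<And>x. f (x + p) = f x"
  shows "integral {a..a + p} f = integral {b..b + p} f"
proof (cases "p > 0")
  case True
  have int: "f integrable_on {u..v}" for u v
    using cont by (intro integrable_continuous_real) (auto intro: continuous_on_subset)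
  have shift: "integral {u + p..v + p} f = integral {u..v} f" for u v
    using integral_shift_Icc_real[of u v f p] per by (simp add: o_def add.commute[of p])
  have *: "integral {a..a + p} f = integral {b..b + p} f" if "a \<le> b" for a b
  proof -
    have "integral {a..b} f + integral {b..b + p} f = integral {a..b + p} f"
      using that True int by (intro Henstock_Kurzweil_Integration.integral_combine) auto
    moreover have "integral {a..a + p} f + integral {a + p..b + p} f = integral {a..b + p} f"
      using that True int by (intro Henstock_Kurzweil_Integration.integral_combine) auto
    ultimately show ?thesis
      by (metis shift add.commute add_left_cancel)
  qed
  then show ?thesis
    by (metis nle_le)
next
  case False
  then show ?thesis by (cases "p = 0") auto
qed

lemma integral_angle_measure_reflect:
  fixes f :: "real \<Rightarrow> 'b::euclidean_space"
  assumes cont: "continuous_on UNIV f" and per: "\<And>x. f (x + 2 * pi) = f x"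
  shows "(\<integral>t. f (x - t) \<partial>angle_measure) = integral\<^sup>L angle_measure f"
proof -
  have contr: "continuous_on UNIV (\<lambda>t. f (x - t))"
    by (intro continuous_on_compose2[OF cont] continuous_intros) auto
  have "integral {-pi..pi} (\<lambda>t. f (x - t)) = integral {-pi..pi} (\<lambda>t. f (x + t))"
    using Henstock_Kurzweil_Integration.integral_reflect_real[of pi "-pi" "\<lambda>t. f (x + t)"] by simp
  also have "\<dots> = integral {x - pi..x - pi + 2 * pi} f"
    using integral_shift_Icc_real[of "-pi" pi f x] by (simp add: o_def add.commute[of pi])
  also have "\<dots> = integral {-pi..-pi + 2 * pi} f"
    by (intro integral_period_shift cont per)
  finally show ?thesis
    using contr cont by (simp add: integral_angle_measure_continuous)
qed

text \<open>Cauchy's formula at the centre: \<open>du / u\<close> becomes \<open>i dt\<close> along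
  the circle, and periodicity moves the parameter interval from \<open>[0, 2 pi]\<close> to
  \<open>[-pi, pi]\<close>.\<close>

lemma circle_mean_value:
  assumes hol: "f holomorphic_on ball 0 R" and r: "0 \<le> r" "r < R"
  shows "(\<integral>t. f (of_real r * cis t) \<partial>angle_measure) = f 0"
proof (cases "r = 0")
  case True
  interpret prob_space angle_measure by (rule prob_space_angle_measure)
  show ?thesis using True by (simp add: prob_space)
next
  case False
  have sub: "cball 0 r \<subseteq> ball (0::complex) R"
    using r by auto
  have contf: "continuous_on (ball 0 R) f"
    using hol by (rule holomorphic_on_imp_continuous_on)
  have cont: "continuous_on UNIV (\<lambda>t. f (of_real r * cis t))"
    using r by (intro continuous_on_compose2[OF contf] continuous_intros) (auto simp: norm_mult)
  have "((\<lambda>u. f u / (u - 0)) has_contour_integral (2 * of_real pi * \<i> * f 0)) (circlepath 0 r)"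
    using r False sub hol contf
    by (intro Cauchy_integral_circlepath) (auto intro: continuous_on_subset holomorphic_on_subset)
  then have "2 * of_real pi * \<i> * f 0 = contour_integral (circlepath 0 r) (\<lambda>u. f u / (u - 0))"
    by (simp add: contour_integral_unique)
  also have "\<dots> = integral {0..2 * pi} (\<lambda>t. \<i> * f (of_real r * cis t))"
    unfolding circlepath_def using False
    by (subst contour_integral_part_circlepath_eq)
       (auto intro!: Henstock_Kurzweil_Integration.integral_cong simp: field_simps)
  also have "\<dots> = \<i> * integral {0..0 + 2 * pi} (\<lambda>t. f (of_real r * cis t))"
    by simp
  also have "integral {0..0 + 2 * pi} (\<lambda>t. f (of_real r * cis t)) =
      integral {-pi..-pi + 2 * pi} (\<lambda>t. f (of_real r * cis t))"
    by (intro integral_period_shift cont) (simp add: cis.code)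
  finally have "integral {-pi..pi} (\<lambda>t. f (of_real r * cis t)) = 2 * of_real pi * f 0"
    by (simp add: mult.assoc)
  then show ?thesis
    using cont by (simp add: integral_angle_measure_continuous scaleR_conv_of_real)
qed

subsection \<open>The Herglotz kernel and the periodic Hilbert transform\<close>

text \<open>On \<open>[0, pi / 2]\<close> the concave sine lies above its chord; oddness covers
  negative arguments.\<close>

lemma jordan_sin_bound:
  fixes x :: real
  assumes "\<bar>x\<bar> \<le> pi / 2"
  shows "2 / pi * \<bar>x\<bar> \<le> \<bar>sin x\<bar>"
proof -
  have "concave_on {0..pi / 2} sin"
    by (rule f''_le0_imp_concave[where f' = cos and f'' = "\<lambda>x. - sin x"])
       (auto intro!: derivative_eq_intros sin_ge_zero)
  then have "sin y \<ge> 2 / pi * y" if "y \<in> {0..pi / 2}" for y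
    using concave_onD_Icc'[of 0 "pi / 2" sin y] that by simp
  from this[of "\<bar>x\<bar>"] show ?thesis
    using assms by (cases "x \<ge> 0") auto
qed

lemma abs_cot_half_le:
  assumes "\<bar>t\<bar> \<le> pi"
  shows "\<bar>cot (t / 2)\<bar> * \<bar>t\<bar> \<le> pi"
proof (cases "sin (t / 2) = 0")
  case False
  have "\<bar>t\<bar> \<le> pi * \<bar>sin (t / 2)\<bar>"
    using jordan_sin_bound[of "t / 2"] assms by (simp add: field_simps)
  then have "\<bar>cos (t / 2)\<bar> * \<bar>t\<bar> \<le> 1 * (pi * \<bar>sin (t / 2)\<bar>)"
    by (intro mult_mono) auto
  then show ?thesis
    using False by (simp add: cot_def abs_divide field_simps)
qed (simp add: cot_def)

text \<open>At \<open>r * cis t\<close> the real part is the Poisson kernel and the imaginary part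
  the conjugate Poisson kernel, so integration against a density yields its harmonic extension and
  the conjugate function at once.\<close>

definition herglotz :: "complex \<Rightarrow> complex"
  where "herglotz w = (1 + w) / (1 - w)"

lemma one_minus_nonzero: "norm w < 1 \<Longrightarrow> 1 - w \<noteq> (0::complex)"
  by auto

lemma continuous_on_herglotz [continuous_intros]:
  assumes "continuous_on S f" "\<And>x. x \<in> S \<Longrightarrow> norm (f x) < 1"
  shows "continuous_on S (\<lambda>x. herglotz (f x))"
  unfolding herglotz_def
  using assms one_minus_nonzero by (intro continuous_intros) auto

text \<open>Dividing numerator and denominator by \<open>cis (t / 2)\<close> leaves
  \<open>2 cos (t / 2)\<close> over \<open>- 2 i sin (t / 2)\<close>. The real part vanishes: on the
  boundary the Poisson kernel has concentrated at \<open>t = 0\<close>.\<close>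

lemma herglotz_boundary:
  assumes "t \<in> {-pi<..<pi} - {0}"
  shows "herglotz (cis t) = \<i> * cot (t / 2)"
proof -
  define s where "s = t / 2"
  have s: "sin s \<noteq> 0" "t = 2 * s"
    using sin_zero_pi_iff[of s] assms by (auto simp: s_def abs_if)
  then have "cos (2 * s) \<noteq> 1"
    by (simp add: cos_double_sin)
  then have ne: "1 - cis t \<noteq> 0"
    using s by (auto simp: complex_eq_iff)
  have "cos s * sin (2 * s) = (1 + cos (2 * s)) * sin s"
    by (simp add: sin_double cos_double_cos power2_eq_square)
  moreover have "cos s * (1 - cos (2 * s)) = sin (2 * s) * sin s"
    by (simp add: sin_double cos_double_sin power2_eq_square)
  ultimately have "1 + cis t = \<i> * cot s * (1 - cis t)"
    using s by (simp add: complex_eq_iff cot_def field_simps)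
  then show ?thesis
    using ne by (simp add: herglotz_def s_def)
qed

text \<open>A bound of order \<open>1 / |t|\<close> uniform in \<open>r\<close>, to serve as
  majorant when \<open>r\<close> tends to \<open>1\<close>. The squared denominator is
  \<open>(1 - r)^2 + 4 r sin(t/2)^2\<close>, hence at least \<open>sin(t/2)^2\<close>, and the sine
  bound turns this into a multiple of \<open>|t|\<close>.\<close>

lemma norm_herglotz_le:
  assumes r: "1 / 2 \<le> r" "r < 1" and t: "\<bar>t\<bar> \<le> pi"
  shows "norm (herglotz (of_real r * cis t)) * \<bar>t\<bar> \<le> 2 * pi"
proof -
  have "(norm (1 - of_real r * cis t))\<^sup>2 = (1 - r * cos t)\<^sup>2 + (r * sin t)\<^sup>2"
    by (simp add: cmod_power2)
  also have "\<dots> = 1 - 2 * r * cos t + r\<^sup>2 * ((cos t)\<^sup>2 + (sin t)\<^sup>2)"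
    by algebra
  also have "\<dots> = 1 - 2 * r * cos t + r\<^sup>2"
    by simp
  also have "\<dots> = (1 - r)\<^sup>2 + 4 * r * (sin (t / 2))\<^sup>2"
  proof -
    have "cos t = 1 - 2 * (sin (t / 2))\<^sup>2"
      using cos_double_sin[of "t / 2"] by simp
    then show ?thesis by algebra
  qed
  also have "\<dots> \<ge> 0 + 1 * (sin (t / 2))\<^sup>2"
    using r by (intro add_mono mult_right_mono) auto
  finally have "\<bar>sin (t / 2)\<bar> \<le> norm (1 - of_real r * cis t)"
    by (simp flip: abs_le_square_iff)
  moreover have "\<bar>t\<bar> \<le> pi * \<bar>sin (t / 2)\<bar>"
    using jordan_sin_bound[of "t / 2"] t by (simp add: field_simps)
  ultimately have *: "\<bar>t\<bar> \<le> pi * norm (1 - of_real r * cis t)"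
    by (meson mult_left_mono order_trans pi_ge_zero)
  have "norm (1 + of_real r * cis t) \<le> 2"
    using norm_triangle_ineq[of 1 "of_real r * cis t"] r by (simp add: norm_mult)
  then have "norm (1 + of_real r * cis t) * \<bar>t\<bar> \<le> 2 * (pi * norm (1 - of_real r * cis t))"
    using * by (intro mult_mono) auto
  moreover have "norm (1 - of_real r * cis t) > 0"
    using one_minus_nonzero[of "of_real r * cis t"] r by (simp add: norm_mult)
  ultimately show ?thesis
    by (simp add: herglotz_def norm_divide field_simps)
qed

lemma integral_herglotz:
  assumes "0 \<le> r" "r < 1"
  shows "(\<integral>t. herglotz (of_real r * cis t) \<partial>angle_measure) = 1"
proof -
  have "herglotz holomorphic_on ball 0 1"
    unfolding herglotz_def by (intro holomorphic_intros) auto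
  from circle_mean_value[OF this assms] show ?thesis
    by (simp add: herglotz_def)
qed

text \<open>Differentiation under the integral sign: with \<open>w = cis (- y)\<close>, the kernel
  \<open>(1 + z w) / (1 - z w)\<close> has \<open>z\<close>-derivative
  \<open>2 w / (1 - z w)^2\<close>, jointly continuous since \<open>|z w| < 1\<close>.\<close>

lemma holomorphic_herglotz_transform:
  fixes m :: "real \<Rightarrow> real"
  assumes m: "continuous_on UNIV m"
  shows "(\<lambda>z. \<integral>y. herglotz (z * cis (- y)) * of_real (m y) \<partial>angle_measure) holomorphic_on ball 0 1"
proof -
  have lt: "norm (z * cis s) < 1" if "z \<in> ball 0 1" for z s
    using that by (simp add: norm_mult)
  have cont: "continuous_on UNIV (\<lambda>y. herglotz (z * cis (- y)) * of_real (m y))"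
    if "z \<in> ball 0 1" for z
    using lt that by (intro continuous_intros m) auto
  have m': "continuous_on S (\<lambda>x. m (f x))" if "continuous_on S f" for f and S :: "(complex \<times> real) set"
    by (rule continuous_on_compose2[OF m that]) auto
  have "(\<lambda>z. integral (cbox (-pi) pi) (\<lambda>y. herglotz (z * cis (- y)) * of_real (m y)))
      holomorphic_on ball 0 1"
  proof (rule leibniz_rule_holomorphic
      [where fx = "\<lambda>z y. 2 * cis (- y) / (1 - z * cis (- y))\<^sup>2 * of_real (m y)"])
    show "((\<lambda>z. herglotz (z * cis (- y)) * of_real (m y)) has_field_derivative
        2 * cis (- y) / (1 - z * cis (- y))\<^sup>2 * of_real (m y)) (at z within ball 0 1)"
      if "z \<in> ball 0 1" for z y
      using one_minus_nonzero[OF lt[OF that, of "- y"]] unfolding herglotz_def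
      by (auto intro!: derivative_eq_intros simp: field_simps power2_eq_square)
    show "(\<lambda>y. herglotz (z * cis (- y)) * of_real (m y)) integrable_on cbox (-pi) pi"
      if "z \<in> ball 0 1" for z
      using cont[OF that] by (intro integrable_continuous) (auto intro: continuous_on_subset)
    show "continuous_on (ball 0 1 \<times> cbox (-pi) pi)
        (\<lambda>(z, y). 2 * cis (- y) / (1 - z * cis (- y))\<^sup>2 * of_real (m y))"
      using one_minus_nonzero[OF lt] unfolding split_beta
      by (intro continuous_intros m') auto
  qed auto
  then have "(\<lambda>z. integral (cbox (-pi) pi) (\<lambda>y. herglotz (z * cis (- y)) * of_real (m y)) / (2 * pi))
      holomorphic_on ball 0 1"
    by (intro holomorphic_intros) auto
  then show ?thesis
    by (rule holomorphic_transform)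
       (subst integral_angle_measure_continuous[OF cont], auto simp: scaleR_conv_of_real field_simps)
qed

text \<open>Subtracting \<open>m x\<close> does not change the principal value, because the cotangent is odd, and it makes
  the integral absolutely convergent for Lipschitz \<open>m\<close>.\<close>

definition periodic_hilbert :: "(real \<Rightarrow> real) \<Rightarrow> real \<Rightarrow> real"
  where "periodic_hilbert m x = (\<integral>t. cot (t / 2) * (m (x - t) - m x) \<partial>angle_measure)"

section \<open>Boundary values of the Herglotz transform of a Lipschitz density\<close>

locale periodic_lipschitz =
  fixes m :: "real \<Rightarrow> real" and L :: real
  assumes cont: "continuous_on UNIV m"
    and per: "\<And>x. m (x + 2 * pi) = m x"
    and lip: "\<And>x t. \<bar>x\<bar> \<le> pi \<Longrightarrow> \<bar>t\<bar> \<le> pi \<Longrightarrow> \<bar>m (x - t) - m x\<bar> \<le> L * \<bar>t\<bar>"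
begin

lemma measurable_m [measurable]: "m \<in> borel_measurable borel"
  by (intro borel_measurable_continuous_onI cont)

lemma L_nonneg: "0 \<le> L"
  using lip[of 0 1] pi_gt3 by simp

definition cauchy_transform :: "real \<Rightarrow> real \<Rightarrow> complex"
  where "cauchy_transform r x = (\<integral>t. herglotz (of_real r * cis t) * of_real (m (x - t)) \<partial>angle_measure)"

definition disc_extension :: "complex \<Rightarrow> complex"
  where "disc_extension z = (\<integral>y. herglotz (z * cis (- y)) * of_real (m y) \<partial>angle_measure)"

lemma continuous_m_compose [continuous_intros]: "continuous_on S f \<Longrightarrow> continuous_on S (\<lambda>x. m (f x))"
  by (rule continuous_on_compose2[OF cont]) auto

text \<open>The two forms serve different ends: \<open>cauchy_transform\<close> keeps the
  singularity of the kernel at \<open>t = 0\<close>, which suits estimates, while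
  \<open>disc_extension\<close> is visibly holomorphic in its argument. The substitution
  \<open>y = x - t\<close> links them.\<close>

lemma cauchy_transform_eq:
  assumes "0 \<le> r" "r < 1"
  shows "cauchy_transform r x = disc_extension (of_real r * cis x)"
proof -
  let ?f = "\<lambda>y. herglotz (of_real r * cis x * cis (- y)) * of_real (m y)"
  have c: "continuous_on UNIV ?f"
    using assms by (intro continuous_intros) (auto simp: norm_mult)
  have "?f (y + 2 * pi) = ?f y" for y
  proof -
    have "cis (- y - 2 * pi) = cis (- y) / cis (2 * pi)"
      by (simp only: cis_divide)
    then show ?thesis
      using per[of y] by simp
  qed
  from integral_angle_measure_reflect[OF c this, of x] show ?thesis
    by (simp add: cauchy_transform_def disc_extension_def cis_mult mult.assoc)
qed

text \<open>The kernel has mean \<open>1\<close>, so \<open>m x\<close> splits off. What remains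
  contains the increment \<open>m (x - t) - m x\<close>, whose size \<open>L * |t|\<close>
  compensates the singularity.\<close>

lemma cauchy_transform_decomp:
  assumes "0 \<le> r" "r < 1"
  shows "cauchy_transform r x = of_real (m x) +
    (\<integral>t. herglotz (of_real r * cis t) * of_real (m (x - t) - m x) \<partial>angle_measure)"
proof -
  have i1: "integrable angle_measure (\<lambda>t. herglotz (of_real r * cis t) * of_real (m (x - t)))"
    and i2: "integrable angle_measure (\<lambda>t. herglotz (of_real r * cis t) * of_real (m x))"
    using assms by (auto intro!: integrable_angle_measure_continuous continuous_intros simp: norm_mult)
  have "(\<integral>t. herglotz (of_real r * cis t) * of_real (m (x - t) - m x) \<partial>angle_measure) =
      cauchy_transform r x - (\<integral>t. herglotz (of_real r * cis t) * of_real (m x) \<partial>angle_measure)"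
    unfolding cauchy_transform_def using i1 i2
    by (subst Bochner_Integration.integral_diff[symmetric]) (auto simp: algebra_simps)
  also have "(\<integral>t. herglotz (of_real r * cis t) * of_real (m x) \<partial>angle_measure) = of_real (m x)"
    using integral_herglotz[OF assms] by simp
  finally show ?thesis by simp
qed

lemma kernel_bound:
  assumes "1 / 2 \<le> r" "r < 1" "\<bar>x\<bar> \<le> pi" "\<bar>t\<bar> \<le> pi"
  shows "norm (herglotz (of_real r * cis t) * of_real (m (x - t) - m x)) \<le> 2 * pi * L"
proof -
  have "norm (herglotz (of_real r * cis t) * of_real (m (x - t) - m x)) \<le>
      norm (herglotz (of_real r * cis t)) * (L * \<bar>t\<bar>)"
    using lip[OF assms(3,4)] by (simp add: norm_mult mult_left_mono del: of_real_diff)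
  also have "\<dots> \<le> 2 * pi * L"
    using mult_right_mono[OF norm_herglotz_le[OF assms(1,2,4)] L_nonneg] by (simp add: mult_ac)
  finally show ?thesis .
qed

lemma continuous_herglotz_kernel:
  "0 \<le> r \<Longrightarrow> r < 1 \<Longrightarrow>
    continuous_on UNIV (\<lambda>t. herglotz (of_real r * cis t) * of_real (m (x - t) - m x))"
  by (intro continuous_intros) (auto simp: norm_mult)

lemma norm_cauchy_transform_le:
  assumes "1 / 2 \<le> r" "r < 1" "\<bar>x\<bar> \<le> pi"
  shows "norm (cauchy_transform r x) \<le> \<bar>m x\<bar> + 2 * pi * L"
  using norm_triangle_ineq[of "of_real (m x)"] assms
    norm_integral_angle_measure_le
      [OF borel_measurable_continuous_onI[OF continuous_herglotz_kernel], of r x, OF _ _ kernel_bound]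
  by (simp add: cauchy_transform_decomp norm_triangle_le)

text \<open>The summand \<open>m x\<close> survives from the mass of the Poisson kernel. In the
  other summand the kernel tends to \<open>i cot (t / 2)\<close> away from \<open>t = 0\<close>,
  under the constant majorant of \<open>kernel_bound\<close>.\<close>

lemma cauchy_transform_tendsto:
  assumes "\<And>n. 1 / 2 \<le> r n" "\<And>n. r n < 1" "r \<longlonglongrightarrow> 1" "\<bar>x\<bar> \<le> pi"
  shows "(\<lambda>n. cauchy_transform (r n) x) \<longlonglongrightarrow> of_real (m x) + \<i> * of_real (periodic_hilbert m x)"
proof -
  interpret prob_space angle_measure by (rule prob_space_angle_measure)
  have r0: "0 \<le> r n" for n
    using assms(1)[of n] by simp
  have "(\<lambda>n. \<integral>t. herglotz (of_real (r n) * cis t) * of_real (m (x - t) - m x) \<partial>angle_measure)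
      \<longlonglongrightarrow> (\<integral>t. \<i> * of_real (cot (t / 2) * (m (x - t) - m x)) \<partial>angle_measure)"
  proof (rule integral_dominated_convergence[where w = "\<lambda>_. 2 * pi * L"])
    show "AE t in angle_measure. (\<lambda>n. herglotz (of_real (r n) * cis t) * of_real (m (x - t) - m x))
        \<longlonglongrightarrow> \<i> * of_real (cot (t / 2) * (m (x - t) - m x))"
      using AE_angle_measure
    proof eventually_elim
      fix t assume t: "t \<in> {-pi<..<pi} - {0}"
      have "1 - cis t \<noteq> 0"
        using t sin_zero_pi_iff[of t] by (auto simp: complex_eq_iff abs_less_iff)
      then have "(\<lambda>n. herglotz (of_real (r n) * cis t)) \<longlonglongrightarrow> herglotz (of_real 1 * cis t)"
        unfolding herglotz_def by (intro tendsto_intros assms) auto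
      then show "(\<lambda>n. herglotz (of_real (r n) * cis t) * of_real (m (x - t) - m x))
        \<longlonglongrightarrow> \<i> * of_real (cot (t / 2) * (m (x - t) - m x))"
        using herglotz_boundary[OF t] by (auto intro!: tendsto_eq_intros)
    qed
    show "AE t in angle_measure. norm (herglotz (of_real (r n) * cis t) * of_real (m (x - t) - m x)) \<le> 2 * pi * L" for n
      using AE_angle_measure
      by eventually_elim (rule kernel_bound; use assms in \<open>simp add: abs_le_iff\<close>)
  qed (use borel_measurable_continuous_onI[OF continuous_herglotz_kernel[OF r0 assms(2)]] in
        \<open>auto simp: cot_def\<close>)
  then have "(\<lambda>n. of_real (m x) + (\<integral>t. herglotz (of_real (r n) * cis t) * of_real (m (x - t) - m x) \<partial>angle_measure))
      \<longlonglongrightarrow> of_real (m x) + \<i> * of_real (periodic_hilbert m x)"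
    unfolding periodic_hilbert_def by (intro tendsto_intros) (simp del: of_real_mult of_real_diff)
  then show ?thesis
    using r0 assms(2) by (simp add: cauchy_transform_decomp)
qed

lemma measurable_periodic_hilbert [measurable]: "periodic_hilbert m \<in> borel_measurable borel"
proof -
  interpret prob_space angle_measure by (rule prob_space_angle_measure)
  show ?thesis
    unfolding periodic_hilbert_def[abs_def] cot_def by measurable
qed

lemma hilbert_kernel_bound:
  assumes "\<bar>x\<bar> \<le> pi" "\<bar>t\<bar> \<le> pi"
  shows "\<bar>cot (t / 2) * (m (x - t) - m x)\<bar> \<le> pi * L"
proof -
  have "\<bar>cot (t / 2) * (m (x - t) - m x)\<bar> \<le> \<bar>cot (t / 2)\<bar> * (L * \<bar>t\<bar>)"
    using lip[OF assms] by (simp add: abs_mult mult_left_mono)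
  also have "\<dots> \<le> pi * L"
    using mult_right_mono[OF abs_cot_half_le[OF assms(2)] L_nonneg] by (simp add: mult_ac)
  finally show ?thesis .
qed

lemma abs_periodic_hilbert_le:
  assumes "\<bar>x\<bar> \<le> pi"
  shows "\<bar>periodic_hilbert m x\<bar> \<le> pi * L"
  unfolding periodic_hilbert_def real_norm_def[symmetric]
  by (rule norm_integral_angle_measure_le) (use hilbert_kernel_bound[OF assms] in \<open>auto simp: cot_def\<close>)

lemma bounded_m: obtains B where "\<And>x. \<bar>x\<bar> \<le> pi \<Longrightarrow> \<bar>m x\<bar> \<le> B"
proof -
  have "compact (m ` {-pi..pi})"
    using cont by (intro compact_continuous_image) (auto intro: continuous_on_subset)
  then obtain B where "\<And>x. x \<in> {-pi..pi} \<Longrightarrow> norm (m x) \<le> B"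
    by (force simp: bounded_iff dest: compact_imp_bounded)
  then show ?thesis by (intro that[of B]) (auto simp: abs_le_iff)
qed

text \<open>The mean value property is applied to the cube of \<open>disc_extension\<close> at radii
  below \<open>1\<close>, then passed to the limit; the real part of \<open>(a + i b)^3\<close> is
  \<open>a^3 - 3 a b^2\<close>.\<close>

lemma integral_cube_hilbert:
  "(\<integral>x. (m x)^3 - 3 * m x * (periodic_hilbert m x)\<^sup>2 \<partial>angle_measure) = (\<integral>x. m x \<partial>angle_measure)^3"
proof -
  interpret prob_space angle_measure by (rule prob_space_angle_measure)
  \<comment> \<open>The offset \<open>2\<close> keeps \<open>r n\<close> in \<open>[1/2, 1)\<close>,
    the range in which the kernel estimates hold.\<close>
  define r :: "nat \<Rightarrow> real" where "r n = 1 - 1 / real (n + 2)" for n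
  have r: "1 / 2 \<le> r n" "0 \<le> r n" "r n < 1" for n
    by (simp_all add: r_def field_simps)
  have r1: "r \<longlonglongrightarrow> 1"
    unfolding r_def by real_asymp
  obtain B where B: "\<And>x. \<bar>x\<bar> \<le> pi \<Longrightarrow> \<bar>m x\<bar> \<le> B"
    by (rule bounded_m) blast
  have hol: "disc_extension holomorphic_on ball 0 1"
    using holomorphic_herglotz_transform[OF cont] by (simp add: disc_extension_def[abs_def])
  have contF: "continuous_on UNIV (cauchy_transform (r n))" for n
    unfolding cauchy_transform_eq[OF r(2,3), abs_def]
    using r by (intro continuous_on_compose2[OF holomorphic_on_imp_continuous_on[OF hol]] continuous_intros)
      (auto simp: norm_mult)
  let ?F = "\<lambda>x. of_real (m x) + \<i> * of_real (periodic_hilbert m x) :: complex"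
  have "(\<lambda>n. \<integral>x. (cauchy_transform (r n) x)^3 \<partial>angle_measure) \<longlonglongrightarrow> (\<integral>x. (?F x)^3 \<partial>angle_measure)"
  proof (rule integral_dominated_convergence[where w = "\<lambda>_. (B + 2 * pi * L)^3"])
    show "AE x in angle_measure. (\<lambda>n. (cauchy_transform (r n) x)^3) \<longlonglongrightarrow> (?F x)^3"
      using AE_angle_measure
      by eventually_elim (intro tendsto_power cauchy_transform_tendsto r r1, auto)
    show "AE x in angle_measure. norm ((cauchy_transform (r n) x)^3) \<le> (B + 2 * pi * L)^3" for n
      using AE_angle_measure
    proof eventually_elim
      fix x assume "x \<in> {-pi<..<pi} - {0}"
      then have "\<bar>x\<bar> \<le> pi"
        by (simp add: abs_le_iff)
      then have "norm (cauchy_transform (r n) x) \<le> B + 2 * pi * L"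
        using norm_cauchy_transform_le[OF r(1,3)[of n], of x] B[of x] by auto
      then show "norm ((cauchy_transform (r n) x)^3) \<le> (B + 2 * pi * L)^3"
        unfolding norm_power by (rule power_mono) simp
    qed
  qed (use borel_measurable_continuous_onI[OF contF] in auto)
  moreover have "(\<integral>x. (cauchy_transform (r n) x)^3 \<partial>angle_measure) = (disc_extension 0)^3" for n
    using circle_mean_value[of "\<lambda>z. (disc_extension z)^3", OF _ r(2,3)] hol
    by (simp add: cauchy_transform_eq[OF r(2,3)] holomorphic_on_power)
  \<comment> \<open>\<open>herglotz 0 = 1\<close>, so the value at the centre is the mean of
    \<open>m\<close>.\<close>
  moreover have "disc_extension 0 = of_real (\<integral>x. m x \<partial>angle_measure)"
    by (simp add: disc_extension_def herglotz_def)
  ultimately have eq: "(\<integral>x. (?F x)^3 \<partial>angle_measure) = of_real ((\<integral>x. m x \<partial>angle_measure)^3)"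
    by (simp add: LIMSEQ_const_iff)
  have "integrable angle_measure (\<lambda>x. (?F x)^3)"
  proof (rule integrable_angle_measure[where B = "(B + pi * L)^3"])
    fix x :: real assume x: "\<bar>x\<bar> \<le> pi"
    have "norm (?F x) \<le> B + pi * L"
      using B[OF x] abs_periodic_hilbert_le[OF x] by (intro norm_triangle_le) (simp add: norm_mult)
    then show "norm ((?F x)^3) \<le> (B + pi * L)^3"
      unfolding norm_power by (rule power_mono) simp
  qed auto
  then have "(\<integral>x. Re ((?F x)^3) \<partial>angle_measure) = (\<integral>x. m x \<partial>angle_measure)^3"
    using integral_Re eq by (metis Re_complex_of_real)
  moreover have "Re ((?F x)^3) = (m x)^3 - 3 * m x * (periodic_hilbert m x)\<^sup>2" for x
    by (simp add: power3_eq_cube power2_eq_square algebra_simps)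
  ultimately show ?thesis by simp
qed

lemma integral_hilbert_square:
  "(\<integral>x. m x * (periodic_hilbert m x)\<^sup>2 \<partial>angle_measure) =
    ((\<integral>x. (m x)^3 \<partial>angle_measure) - (\<integral>x. m x \<partial>angle_measure)^3) / 3"
proof -
  obtain B where B: "\<And>x. \<bar>x\<bar> \<le> pi \<Longrightarrow> \<bar>m x\<bar> \<le> B"
    by (rule bounded_m) blast
  have i1: "integrable angle_measure (\<lambda>x. (m x)^3)"
    by (intro integrable_angle_measure_continuous continuous_intros) 
  have i2: "integrable angle_measure (\<lambda>x. m x * (periodic_hilbert m x)\<^sup>2)"
  proof (rule integrable_angle_measure[where B = "B * (pi * L)\<^sup>2"])
    fix x :: real assume x: "\<bar>x\<bar> \<le> pi"
    have "(periodic_hilbert m x)\<^sup>2 \<le> (pi * L)\<^sup>2"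
      using abs_periodic_hilbert_le[OF x] power_mono[OF _ abs_ge_zero, of _ _ 2] by fastforce
    then show "norm (m x * (periodic_hilbert m x)\<^sup>2) \<le> B * (pi * L)\<^sup>2"
      unfolding norm_mult using B[OF x] by (intro mult_mono) auto
  qed auto
  have "(\<integral>x. (m x)^3 - 3 * (m x * (periodic_hilbert m x)\<^sup>2) \<partial>angle_measure) =
      (\<integral>x. (m x)^3 \<partial>angle_measure) - 3 * (\<integral>x. m x * (periodic_hilbert m x)\<^sup>2 \<partial>angle_measure)"
    using i1 i2 by (subst Bochner_Integration.integral_diff) auto
  then show ?thesis
    using integral_cube_hilbert by (simp add: mult.assoc)
qed

end

subsection \<open>Fisher information of a smooth measure\<close>

lemma measurable_cis_circle: "cis \<in> measurable borel (restrict_space borel unit_circle)"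
  by (intro measurable_restrict_space2 borel_measurable_continuous_onI continuous_intros) auto

lemma sets_circle_haar [measurable_cong]: "sets circle_haar = sets (restrict_space borel unit_circle)"
  by (simp add: circle_haar_def)

lemma space_circle_haar: "space circle_haar = unit_circle"
  by (simp add: circle_haar_def)

lemma measurable_cis_angle: "cis \<in> measurable angle_measure (restrict_space borel unit_circle)"
  using measurable_cis_circle by (simp cong: measurable_cong_sets)

lemma prob_space_circle_haar: "prob_space circle_haar"
  unfolding circle_haar_def
  by (intro prob_space.prob_space_distr prob_space_angle_measure measurable_cis_angle)

lemma integral_circle_haar:
  fixes f :: "complex \<Rightarrow> 'b::{banach,second_countable_topology}"
  assumes "f \<in> borel_measurable circle_haar"
  shows "integral\<^sup>L circle_haar f = (\<integral>x. f (cis x) \<partial>angle_measure)"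
  unfolding circle_haar_def
  using assms by (intro integral_distr measurable_cis_angle) (simp cong: measurable_cong_sets add: sets_circle_haar)

lemma measurable_Arg [measurable]: "Arg \<in> borel_measurable borel"
proof -
  have "Arg = (\<lambda>z. if z = 0 then 0 else Im (Ln z))"
    by (auto simp: Arg_zero Arg_eq_Im_Ln)
  then show ?thesis
    by (subst \<open>Arg = _\<close>) measurable
qed

text \<open>Regularity is known only in the angular coordinate. On the circle \<open>f\<close> is
  the composition of \<open>f o cis\<close> with the Borel function \<open>Arg\<close>, which brings
  measurability back.\<close>

lemma measurable_on_circle_haar:
  assumes "continuous_on UNIV (\<lambda>x. f (cis x))"
  shows "f \<in> borel_measurable (restrict_space borel unit_circle)"
proof -
  have [measurable]: "(\<lambda>x. f (cis x)) \<in> borel_measurable borel"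
    using assms by (rule borel_measurable_continuous_onI)
  have "(\<lambda>z. (\<lambda>x. f (cis x)) (Arg z)) \<in> borel_measurable borel"
    by measurable
  then have meas: "(\<lambda>z. f (cis (Arg z))) \<in> borel_measurable (restrict_space borel unit_circle)"
    by (rule measurable_restrict_space1)
  have "f z = f (cis (Arg z))" if "z \<in> space (restrict_space borel unit_circle)" for z
  proof -
    have "norm z = 1"
      using that by (simp add: space_restrict_space)
    then have "cis (Arg z) = z"
      by (subst cis_Arg) (auto simp: sgn_eq)
    then show ?thesis by simp
  qed
  with meas show ?thesis
    by (subst measurable_cong)
qed

text \<open>The derivative in the angle is continuous, hence bounded on
  \<open>[-2 pi, 2 pi]\<close>, an interval that contains both \<open>x\<close> and
  \<open>x - t\<close>.\<close>

lemma smooth_on_circle_periodic_lipschitz: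
  assumes "smooth_on_circle m"
  shows "\<exists>L. periodic_lipschitz (\<lambda>x. m (cis x)) L"
proof -
  let ?m = "\<lambda>x. m (cis x)"
  have diff: "?m field_differentiable (at t)" "deriv ?m field_differentiable (at t)" for t
    using assms[unfolded smooth_on_circle_def, rule_format, of 0 t]
      assms[unfolded smooth_on_circle_def, rule_format, of 1 t] by simp_all
  have cont: "continuous_on S ?m" "continuous_on S (deriv ?m)" for S
    using diff by (auto intro!: continuous_at_imp_continuous_on field_differentiable_imp_continuous_at)
  have "compact (deriv ?m ` {-(2*pi)..2*pi})"
    by (intro compact_continuous_image cont) auto
  then obtain L where L: "\<And>x. x \<in> {-(2*pi)..2*pi} \<Longrightarrow> norm (deriv ?m x) \<le> L"
    by (force simp: bounded_iff dest: compact_imp_bounded)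
  have "\<bar>?m (x - t) - ?m x\<bar> \<le> L * \<bar>t\<bar>" if "\<bar>x\<bar> \<le> pi" "\<bar>t\<bar> \<le> pi" for x t
  proof -
    have "norm (?m (x - t) - ?m x) \<le> L * norm ((x - t) - x)"
    proof (rule field_differentiable_bound[where S = "{-(2*pi)..2*pi}" and f' = "deriv ?m"])
      show "(?m has_field_derivative deriv ?m z) (at z within {-(2*pi)..2*pi})" for z
        using diff(1)[of z] by (auto simp: DERIV_deriv_iff_field_differentiable intro: has_field_derivative_at_within)
    qed (use that L in \<open>auto simp: abs_le_iff\<close>)
    then show ?thesis by simp
  qed
  moreover have "?m (x + 2 * pi) = ?m x" for x
    by (simp flip: cis_mult)
  ultimately have "periodic_lipschitz ?m L"
    by unfold_locales (auto intro: cont)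
  then show ?thesis ..
qed

lemma integral_lborel_diff:
  fixes f :: "real \<Rightarrow> real"
  shows "(\<integral>t. f (x - t) \<partial>lborel) = integral\<^sup>L lborel f"
  using lborel_integral_real_affine[of "-1" f x] by simp

section \<open>The principal value as a limit of truncated integrals\<close>

context periodic_lipschitz
begin

text \<open>After \<open>y = x - t\<close> the truncated region is symmetric about \<open>0\<close>,
  so the cotangent integrates to zero there and the multiple by \<open>m x\<close> may be
  subtracted. Truncation bounds the cotangent by \<open>pi / \<epsilon>\<close>, which makes the two
  terms separately integrable.\<close>

lemma truncated_hilbert_eq:
  assumes x: "\<bar>x\<bar> \<le> pi" and e: "0 < \<epsilon>"
  shows "(LINT y:{y. \<epsilon> < \<bar>x - y\<bar> \<and> \<bar>x - y\<bar> \<le> pi}|lborel. cot ((x - y) / 2) * m y / (2 * pi)) =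
    (\<integral>t. indicator {t. \<epsilon> < \<bar>t\<bar>} t * (cot (t / 2) * (m (x - t) - m x)) \<partial>angle_measure)"
proof -
  let ?I = "\<lambda>t::real. indicator {t. \<epsilon> < \<bar>t\<bar>} t :: real"
  have [measurable]: "(\<lambda>t::real. cot (t / 2)) \<in> borel_measurable borel"
    by (simp add: cot_def)
  have cotb: "\<bar>?I t * cot (t / 2)\<bar> \<le> pi / \<epsilon>" if t: "\<bar>t\<bar> \<le> pi" for t
  proof (cases "\<epsilon> < \<bar>t\<bar>")
    case True
    have "\<bar>cot (t / 2)\<bar> * \<epsilon> \<le> \<bar>cot (t / 2)\<bar> * \<bar>t\<bar>"
      using True by (intro mult_left_mono) auto
    also have "\<dots> \<le> pi"
      by (rule abs_cot_half_le[OF t])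
    finally show ?thesis
      using True e by (simp add: field_simps)
  qed (use e in auto)
  obtain B where B: "\<And>t. \<bar>t\<bar> \<le> pi \<Longrightarrow> \<bar>m (x - t)\<bar> \<le> B"
  proof -
    have "compact ((\<lambda>t. m (x - t)) ` {-pi..pi})"
      by (intro compact_continuous_image continuous_intros) auto
    then obtain B where "\<And>t. t \<in> {-pi..pi} \<Longrightarrow> norm (m (x - t)) \<le> B"
      by (force simp: bounded_iff dest: compact_imp_bounded)
    then show ?thesis by (intro that[of B]) (auto simp: abs_le_iff)
  qed
  have i1: "integrable angle_measure (\<lambda>t. ?I t * cot (t / 2))"
    using cotb by (intro integrable_angle_measure[where B = "pi / \<epsilon>"]) auto
  have i2: "integrable angle_measure (\<lambda>t. ?I t * cot (t / 2) * m (x - t))"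
  proof (rule integrable_angle_measure[where B = "pi / \<epsilon> * B"])
    fix t :: real assume t: "\<bar>t\<bar> \<le> pi"
    show "norm (?I t * cot (t / 2) * m (x - t)) \<le> pi / \<epsilon> * B"
      unfolding norm_mult[of "?I t * cot (t / 2)"] using cotb[OF t] B[OF t] e
      by (intro mult_mono) auto
  qed auto
  have odd: "(\<integral>t. ?I t * cot (t / 2) \<partial>angle_measure) = 0"
  proof -
    let ?g = "\<lambda>t. indicator {-pi..pi} t *\<^sub>R (?I t * cot (t / 2)) :: real"
    have "integral\<^sup>L lborel ?g = (\<integral>t. ?g (0 - t) \<partial>lborel)"
      by (rule integral_lborel_diff[symmetric])
    also have "\<dots> = (\<integral>t. - ?g t \<partial>lborel)"
      by (intro Bochner_Integration.integral_cong) (auto simp: indicator_def)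
    finally have "integral\<^sup>L lborel ?g = 0"
      by simp
    then show ?thesis
      by (simp add: integral_angle_measure set_lebesgue_integral_def)
  qed
  have "(LINT y:{y. \<epsilon> < \<bar>x - y\<bar> \<and> \<bar>x - y\<bar> \<le> pi}|lborel. cot ((x - y) / 2) * m y / (2 * pi)) =
      (\<integral>t. indicator {-pi..pi} t *\<^sub>R (?I t * cot (t / 2) * m (x - t)) / (2 * pi) \<partial>lborel)"
    unfolding set_lebesgue_integral_def
    by (subst integral_lborel_diff[of _ x, symmetric], intro Bochner_Integration.integral_cong)
       (auto simp: indicator_def abs_le_iff)
  also have "\<dots> = (\<integral>t. ?I t * cot (t / 2) * m (x - t) \<partial>angle_measure)"
    by (simp add: integral_angle_measure set_lebesgue_integral_def field_simps)
  also have "\<dots> = (\<integral>t. ?I t * cot (t / 2) * m (x - t) \<partial>angle_measure) -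
      (\<integral>t. ?I t * cot (t / 2) * m x \<partial>angle_measure)"
    using odd by simp
  also have "\<dots> = (\<integral>t. ?I t * cot (t / 2) * m (x - t) - ?I t * cot (t / 2) * m x \<partial>angle_measure)"
    using i1 i2 by (intro Bochner_Integration.integral_diff[symmetric]) auto
  finally show ?thesis
    by (simp add: algebra_simps)
qed

text \<open>For \<open>t \<noteq> 0\<close> the truncation is eventually inactive, and the Lipschitz
  bound gives the constant majorant \<open>pi * L\<close>.\<close>

lemma truncated_hilbert_tendsto:
  assumes x: "\<bar>x\<bar> \<le> pi"
  shows "((\<lambda>\<epsilon>. LINT y:{y. \<epsilon> < \<bar>x - y\<bar> \<and> \<bar>x - y\<bar> \<le> pi}|lborel. cot ((x - y) / 2) * m y / (2 * pi))
    \<longlongrightarrow> periodic_hilbert m x) (at_right 0)"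
proof (rule tendsto_at_right_sequentially[of 0 1])
  fix S :: "nat \<Rightarrow> real" assume S: "\<And>n. 0 < S n" "S \<longlonglongrightarrow> 0"
  interpret prob_space angle_measure by (rule prob_space_angle_measure)
  have [measurable]: "(\<lambda>t::real. cot (t / 2)) \<in> borel_measurable borel"
    by (simp add: cot_def)
  have "(\<lambda>n. \<integral>t. indicator {t. S n < \<bar>t\<bar>} t * (cot (t / 2) * (m (x - t) - m x)) \<partial>angle_measure)
      \<longlonglongrightarrow> periodic_hilbert m x"
    unfolding periodic_hilbert_def
  proof (rule integral_dominated_convergence[where w = "\<lambda>_. pi * L"])
    show "AE t in angle_measure. (\<lambda>n. indicator {t. S n < \<bar>t\<bar>} t * (cot (t / 2) * (m (x - t) - m x)))
        \<longlonglongrightarrow> cot (t / 2) * (m (x - t) - m x)"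
      using AE_angle_measure
    proof eventually_elim
      fix t :: real assume "t \<in> {-pi<..<pi} - {0}"
      then have "\<forall>\<^sub>F n in sequentially. S n < \<bar>t\<bar>"
        by (intro order_tendstoD[OF S(2)]) auto
      then show "(\<lambda>n. indicator {t. S n < \<bar>t\<bar>} t * (cot (t / 2) * (m (x - t) - m x)))
        \<longlonglongrightarrow> cot (t / 2) * (m (x - t) - m x)"
        by (intro tendsto_eventually, elim eventually_mono) simp
    qed
    show "AE t in angle_measure. norm (indicator {t. S n < \<bar>t\<bar>} t * (cot (t / 2) * (m (x - t) - m x))) \<le> pi * L" for n
      using AE_angle_measure
    proof eventually_elim
      fix t :: real assume "t \<in> {-pi<..<pi} - {0}"
      then have "\<bar>t\<bar> \<le> pi" by (simp add: abs_le_iff)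
      from hilbert_kernel_bound[OF x this]
      show "norm (indicator {t. S n < \<bar>t\<bar>} t * (cot (t / 2) * (m (x - t) - m x))) \<le> pi * L"
        using L_nonneg by (auto simp: indicator_def)
    qed
  qed auto
  then show "(\<lambda>n. LINT y:{y. S n < \<bar>x - y\<bar> \<and> \<bar>x - y\<bar> \<le> pi}|lborel. cot ((x - y) / 2) * m y / (2 * pi))
    \<longlonglongrightarrow> periodic_hilbert m x"
    by (simp only: truncated_hilbert_eq[OF x S(1)])
qed simp

end

text \<open>\<open>Lim\<close> is a description and says nothing until convergence is known;
  \<open>truncated_hilbert_tendsto\<close> supplies it.\<close>

lemma circle_hilbert_eq:
  assumes "smooth_on_circle (smooth_density \<mu>)"
  shows "circle_hilbert \<mu> z = periodic_hilbert (\<lambda>x. smooth_density \<mu> (cis x)) (Arg z)"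
proof -
  obtain L where "periodic_lipschitz (\<lambda>x. smooth_density \<mu> (cis x)) L"
    using smooth_on_circle_periodic_lipschitz[OF assms] ..
  then interpret periodic_lipschitz "\<lambda>x. smooth_density \<mu> (cis x)" L .
  have "\<bar>Arg z\<bar> \<le> pi"
    using Arg_bounded[of z] by (simp add: abs_le_iff)
  from truncated_hilbert_tendsto[OF this] show ?thesis
    unfolding circle_hilbert_def Let_def by (intro tendsto_Lim) auto
qed

lemma smooth_density_props:
  assumes "smooth_prob_measure \<mu>"
  shows "is_smooth_density \<mu> (smooth_density \<mu>)"
  using assms someI_ex[of "is_smooth_density \<mu>"]
  by (simp add: smooth_prob_measure_def smooth_density_def)

text \<open>The density is a parameter rather than \<open>smooth_density \<mu>\<close>, so that Haar
  measure can be treated with the explicit density \<open>1\<close>.\<close>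

locale smooth_circle_measure =
  fixes \<mu> :: "complex measure" and m :: "complex \<Rightarrow> real" and L :: real
  assumes prob: "circle_prob_measure \<mu>"
    and nonneg: "\<And>z. z \<in> unit_circle \<Longrightarrow> 0 \<le> m z"
    and density: "\<mu> = density circle_haar (\<lambda>z. ennreal (m z))"
    and lipschitz: "periodic_lipschitz (\<lambda>x. m (cis x)) L"
begin

sublocale periodic_lipschitz "\<lambda>x. m (cis x)" L
  by (rule lipschitz)

sublocale prob_space \<mu>
  using prob by (simp add: circle_prob_measure_def)

lemma measurable_density: "m \<in> borel_measurable circle_haar"
  using measurable_on_circle_haar[OF cont] by (simp cong: measurable_cong_sets add: sets_circle_haar)

lemma integral_smooth:
  fixes f :: "complex \<Rightarrow> 'b::{banach,second_countable_topology}"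
  assumes [measurable]: "f \<in> borel_measurable circle_haar"
  shows "integral\<^sup>L \<mu> f = (\<integral>x. m (cis x) *\<^sub>R f (cis x) \<partial>angle_measure)"
proof -
  note measurable_density [measurable]
  have "integral\<^sup>L \<mu> f = (\<integral>z. m z *\<^sub>R f z \<partial>circle_haar)"
    unfolding density using nonneg by (intro integral_density AE_I2) (auto simp: space_circle_haar)
  also have "\<dots> = (\<integral>x. m (cis x) *\<^sub>R f (cis x) \<partial>angle_measure)"
    by (intro integral_circle_haar) measurable
  finally show ?thesis .
qed

lemma integral_density_eq_1: "(\<integral>x. m (cis x) \<partial>angle_measure) = 1"
  using integral_smooth[of "\<lambda>_. 1 :: real"] prob_space by simp

end

lemma fisher_information_zero:
  assumes "smooth_circle_measure \<mu> (smooth_density \<mu>) L" "smooth_on_circle (smooth_density \<mu>)"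
  shows "fisher_information (\<lambda>_. 0) \<mu> = ((\<integral>x. (smooth_density \<mu> (cis x))^3 \<partial>angle_measure) - 1) / 3"
proof -
  interpret smooth_circle_measure \<mu> "smooth_density \<mu>" L by fact
  let ?m = "\<lambda>x. smooth_density \<mu> (cis x)"
  have "(\<lambda>z. (periodic_hilbert ?m (Arg z))\<^sup>2) \<in> borel_measurable borel"
    by measurable
  then have meas: "(\<lambda>z. (periodic_hilbert ?m (Arg z))\<^sup>2) \<in> borel_measurable circle_haar"
    by (simp cong: measurable_cong_sets add: sets_circle_haar measurable_restrict_space1)
  have "fisher_information (\<lambda>_. 0) \<mu> = (\<integral>z. (periodic_hilbert ?m (Arg z))\<^sup>2 \<partial>\<mu>)"
    by (simp add: fisher_information_def circle_deriv_def circle_hilbert_eq[OF assms(2)])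
  also have "\<dots> = (\<integral>x. ?m x *\<^sub>R (periodic_hilbert ?m (Arg (cis x)))\<^sup>2 \<partial>angle_measure)"
    by (rule integral_smooth[OF meas])
  also have "\<dots> = (\<integral>x. ?m x * (periodic_hilbert ?m x)\<^sup>2 \<partial>angle_measure)"
  proof (rule integral_cong_AE)
    show "AE x in angle_measure. ?m x *\<^sub>R (periodic_hilbert ?m (Arg (cis x)))\<^sup>2 = ?m x * (periodic_hilbert ?m x)\<^sup>2"
      using AE_angle_measure by eventually_elim (simp add: Arg_cis)
    have [measurable]: "cis \<in> borel_measurable borel"
      by (intro borel_measurable_continuous_onI continuous_intros)
    show "(\<lambda>x. ?m x *\<^sub>R (periodic_hilbert ?m (Arg (cis x)))\<^sup>2) \<in> borel_measurable angle_measure"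
      by simp
  qed simp
  finally show ?thesis
    by (simp add: integral_hilbert_square integral_density_eq_1)
qed

subsection \<open>Logarithmic energy\<close>

text \<open>Since \<open>\<bar>x - y\<bar> \<le> 2\<close>, the added constant \<open>ln 2\<close> makes the kernel nonnegative, so that the energy
  becomes a single nonnegative integral.\<close>

definition shifted_log_kernel :: "complex \<Rightarrow> complex \<Rightarrow> ennreal"
  where "shifted_log_kernel x y = (if x = y then \<infinity> else ennreal (ln 2 - ln (cmod (x - y))))"

lemma norm_diff_unit_circle_le:
  "x \<in> unit_circle \<Longrightarrow> y \<in> unit_circle \<Longrightarrow> cmod (x - y) \<le> 2"
  using norm_triangle_ineq4[of x y] by simp

lemma ln_norm_diff_le:
  "x \<in> unit_circle \<Longrightarrow> y \<in> unit_circle \<Longrightarrow> x \<noteq> y \<Longrightarrow> ln (cmod (x - y)) \<le> ln 2"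
  using norm_diff_unit_circle_le by (subst ln_le_cancel_iff) auto

text \<open>Adding \<open>ln 2\<close> to minus the logarithm gives the shifted kernel; here the
  positive part of the logarithm stands on the right, because subtraction in \<open>ennreal\<close>
  truncates. On the diagonal both sides are infinite.\<close>

lemma shifted_log_kernel_split:
  assumes "x \<in> unit_circle" "y \<in> unit_circle"
  shows "e2ennreal (- log_dist x y) + ennreal (ln 2) = shifted_log_kernel x y + e2ennreal (log_dist x y)"
proof (cases "x = y")
  case False
  define l where "l = ln (cmod (x - y))"
  have "l \<le> ln 2"
    unfolding l_def using assms False by (rule ln_norm_diff_le)
  then have "ennreal (- l) + ennreal (ln 2) = ennreal (ln 2 - l) + ennreal l"
    by (cases "l \<ge> 0") (auto simp: ennreal_neg simp flip: ennreal_plus)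
  then show ?thesis
    using False by (simp add: log_dist_def shifted_log_kernel_def l_def)
qed (simp add: log_dist_def shifted_log_kernel_def)

text \<open>The identity compares the regularised kernel \<open>\<bar>1 - r x cnj y\<bar>\<close> with \<open>\<bar>x - y\<bar>\<close> from below, which gives
  the lower bound on the energy of arbitrary measures without a limit theorem.\<close>

lemma norm_one_minus_square:
  assumes "x \<in> unit_circle" "y \<in> unit_circle"
  shows "(cmod (1 - of_real r * (x * cnj y)))\<^sup>2 = (1 - r)\<^sup>2 + r * (cmod (x - y))\<^sup>2"
proof -
  have "(cmod x)\<^sup>2 = 1" "(cmod y)\<^sup>2 = 1"
    using assms by auto
  then have "(Re x)\<^sup>2 + (Im x)\<^sup>2 = 1" "(Re y)\<^sup>2 + (Im y)\<^sup>2 = 1"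
    by (simp_all add: cmod_power2)
  then show ?thesis
    unfolding cmod_power2 by simp algebra
qed

text \<open>A regularisation of \<open>- ln |x - y|\<close>: for unit vectors
  \<open>|x - y| = |1 - x * cnj y|\<close>, and the factor \<open>r < 1\<close> keeps the logarithm
  bounded and inside the disc of convergence of its series.\<close>

definition log_potential :: "real \<Rightarrow> complex \<Rightarrow> complex \<Rightarrow> real"
  where "log_potential r x y = - ln (cmod (1 - of_real r * (x * cnj y)))"

lemma norm_scaled_product:
  "x \<in> unit_circle \<Longrightarrow> y \<in> unit_circle \<Longrightarrow> 0 \<le> r \<Longrightarrow> norm (of_real r * (x * cnj y)) = r"
  by (simp add: norm_mult)

lemma log_potential_ge:
  assumes "x \<in> unit_circle" "y \<in> unit_circle" "0 \<le> r" "r < 1"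
  shows "0 \<le> ln 2 + log_potential r x y"
proof -
  let ?w = "of_real r * (x * cnj y)"
  have w: "norm ?w = r"
    using assms by (intro norm_scaled_product)
  then have "norm (1 - ?w) \<le> 2"
    using norm_triangle_ineq4[of 1 ?w] assms(4) by simp
  moreover have "norm (1 - ?w) > 0"
    using one_minus_nonzero[of ?w] w assms(4) by simp
  ultimately show ?thesis
    by (simp add: log_potential_def)
qed

text \<open>By \<open>norm_one_minus_square\<close> the squared regularised distance is at least
  \<open>r\<close> times the squared distance; taking logarithms costs
  \<open>- ln r / 2\<close>.\<close>

lemma log_potential_le:
  assumes "x \<in> unit_circle" "y \<in> unit_circle" "x \<noteq> y" "0 < r" "r < 1"
  shows "log_potential r x y \<le> - ln (cmod (x - y)) - ln r / 2"
proof -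
  let ?a = "cmod (1 - of_real r * (x * cnj y))" and ?b = "cmod (x - y)"
  have pos: "0 < ?b"
    using assms by simp
  have "r * ?b\<^sup>2 \<le> ?a\<^sup>2"
    using norm_one_minus_square[OF assms(1,2), of r] by simp
  moreover have "0 < r * ?b\<^sup>2"
    using pos assms by simp
  ultimately have "ln (r * ?b\<^sup>2) \<le> ln (?a\<^sup>2)"
    by (subst ln_le_cancel_iff) auto
  moreover have "?a > 0"
    using \<open>0 < r * ?b\<^sup>2\<close> \<open>r * ?b\<^sup>2 \<le> ?a\<^sup>2\<close> by (cases "?a = 0") auto
  ultimately have "ln r + 2 * ln ?b \<le> 2 * ln ?a"
    using pos assms by (simp add: ln_mult ln_realpow)
  then show ?thesis
    by (simp add: log_potential_def)
qed

lemma shifted_log_kernel_ge: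
  assumes "x \<in> unit_circle" "y \<in> unit_circle" "0 < r" "r < 1"
  shows "ennreal (ln 2 + log_potential r x y) \<le> shifted_log_kernel x y + ennreal (- ln r / 2)"
proof (cases "x = y")
  case False
  have "ln (cmod (x - y)) \<le> ln 2"
    using assms False by (intro ln_norm_diff_le)
  moreover have "ln r \<le> 0"
    using assms by simp
  ultimately show ?thesis
    using log_potential_le[OF assms(1,2) False assms(3,4)] False
    by (auto simp: shifted_log_kernel_def simp flip: ennreal_plus intro!: ennreal_leI)
qed (simp add: shifted_log_kernel_def)

text \<open>On the diagonal the regularised distance is \<open>1 - r = 1 / (n + 2)\<close>, so the
  values diverge to the infinite diagonal value; off the diagonal this is continuity in
  \<open>r\<close>.\<close>

lemma log_potential_tendsto:
  assumes "x \<in> unit_circle" "y \<in> unit_circle"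
  shows "(\<lambda>n. ennreal (ln 2 + log_potential (1 - 1 / real (n + 2)) x y)) \<longlonglongrightarrow> shifted_log_kernel x y"
proof (cases "x = y")
  case True
  have "log_potential (1 - 1 / real (n + 2)) x y = ln (real (n + 2))" for n
  proof -
    have "x * cnj x = 1"
      using assms by (simp add: complex_norm_square[symmetric])
    then have "log_potential (1 - 1 / real (n + 2)) x y = - ln (cmod (of_real (1 / real (n + 2))))"
      unfolding log_potential_def using True by simp
    then show ?thesis
      by (simp only: norm_of_real) (simp add: ln_div)
  qed
  moreover have "filterlim (\<lambda>n. ln 2 + ln (real (n + 2))) at_top sequentially"
    by real_asymp
  ultimately show ?thesis
    using True by (simp add: shifted_log_kernel_def ennreal_tendsto_top_eq_at_top del: ennreal_plus)
next
  case False
  let ?r = "\<lambda>n. 1 - 1 / real (n + 2)"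
  have r: "?r \<longlonglongrightarrow> 1"
    by real_asymp
  have "(cmod (1 - of_real 1 * (x * cnj y)))\<^sup>2 = (cmod (x - y))\<^sup>2"
    using norm_one_minus_square[OF assms, of 1] by simp
  then have eq: "cmod (1 - of_real 1 * (x * cnj y)) = cmod (x - y)"
    by (rule power2_eq_imp_eq) auto
  have "(\<lambda>n. log_potential (?r n) x y) \<longlonglongrightarrow> log_potential 1 x y"
    unfolding log_potential_def using eq False by (intro tendsto_intros r) auto
  then have "(\<lambda>n. ennreal (ln 2 + log_potential (?r n) x y)) \<longlonglongrightarrow> ennreal (ln 2 + log_potential 1 x y)"
    by (intro tendsto_intros)
  moreover have "log_potential 1 x y = - ln (cmod (x - y))"
    using eq by (simp add: log_potential_def)
  ultimately show ?thesis
    using False by (simp add: shifted_log_kernel_def)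
qed

text \<open>The real part of the series of \<open>- Ln (1 - w)\<close>. Its summand at
  \<open>k = 0\<close> is \<open>0\<close>, by division by zero.\<close>

lemma log_potential_sums:
  assumes "x \<in> unit_circle" "y \<in> unit_circle" "0 \<le> r" "r < 1"
  shows "(\<lambda>k. Re ((of_real r * (x * cnj y)) ^ k / of_nat k)) sums log_potential r x y"
proof -
  let ?w = "of_real r * (x * cnj y)"
  have w: "norm ?w < 1"
    using norm_scaled_product[OF assms(1-3)] assms(4) by simp
  have "(\<lambda>k. Re (- (- (?w ^ k) / of_nat k))) sums Re (- Ln (1 - ?w))"
    using Ln_series'[of "- ?w"] w by (intro sums_Re sums_minus) simp
  then show ?thesis
    using one_minus_nonzero[OF w] by (simp add: log_potential_def)
qed

section \<open>Energy of a probability measure on the circle in terms of its moments\<close>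

locale circle_probability =
  fixes \<mu> :: "complex measure"
  assumes circle_prob_measure: "circle_prob_measure \<mu>"
begin

sublocale prob_space \<mu>
  using circle_prob_measure by (simp add: circle_prob_measure_def)

sublocale pair_prob_space \<mu> \<mu> ..

lemma sets_eq [measurable_cong]: "sets \<mu> = sets (restrict_space borel unit_circle)"
  using circle_prob_measure by (simp add: circle_prob_measure_def)

lemma space_eq: "space \<mu> = unit_circle"
  using sets_eq_imp_space_eq[OF sets_eq] by (simp add: space_restrict_space)

lemma measurable_borel_circle: "f \<in> borel_measurable borel \<Longrightarrow> f \<in> borel_measurable \<mu>"
  by (simp cong: measurable_cong_sets add: sets_eq measurable_restrict_space1)

lemma measurable_proj [measurable]:
  "fst \<in> borel_measurable (\<mu> \<Otimes>\<^sub>M \<mu>)" "snd \<in> borel_measurable (\<mu> \<Otimes>\<^sub>M \<mu>)"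
  using measurable_compose[OF measurable_fst measurable_borel_circle[OF measurable_ident]]
    measurable_compose[OF measurable_snd measurable_borel_circle[OF measurable_ident]]
  by simp_all

lemma measurable_cnj_snd [measurable]: "(\<lambda>p. cnj (snd p)) \<in> borel_measurable (\<mu> \<Otimes>\<^sub>M \<mu>)"
  by (intro measurable_compose[OF measurable_proj(2)] borel_measurable_continuous_onI continuous_intros)

lemma measurable_log_potential [measurable]:
  "(\<lambda>p. log_potential r (fst p) (snd p)) \<in> borel_measurable (\<mu> \<Otimes>\<^sub>M \<mu>)"
  unfolding log_potential_def by measurable

lemma measurable_log_dist [measurable]:
  "(\<lambda>p. log_dist (fst p) (snd p)) \<in> borel_measurable (\<mu> \<Otimes>\<^sub>M \<mu>)"
  unfolding log_dist_def by measurable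

lemma measurable_shifted_log_kernel [measurable]:
  "(\<lambda>p. shifted_log_kernel (fst p) (snd p)) \<in> borel_measurable (\<mu> \<Otimes>\<^sub>M \<mu>)"
  unfolding shifted_log_kernel_def by measurable

lemma fst_snd_in_circle:
  "p \<in> space (\<mu> \<Otimes>\<^sub>M \<mu>) \<Longrightarrow> fst p \<in> unit_circle \<and> snd p \<in> unit_circle"
  by (auto simp: space_pair_measure space_eq)

text \<open>The positive part of the logarithm has integral \<open>P\<close> at most
  \<open>ln 2\<close>, so the difference defining the energy makes sense even if the integral
  \<open>N\<close> of the negative part is infinite. The pointwise balance integrates to
  \<open>N + ln 2 = K + P\<close>, which is solved separately for finite and infinite
  \<open>N\<close>.\<close>

lemma energy_eq_shifted:
  "energy (\<lambda>_. 0) \<mu> =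
    enn2ereal (\<integral>\<^sup>+p. shifted_log_kernel (fst p) (snd p) \<partial>(\<mu> \<Otimes>\<^sub>M \<mu>)) - ereal (ln 2)"
proof -
  let ?M = "\<mu> \<Otimes>\<^sub>M \<mu>"
  define N where "N = (\<integral>\<^sup>+p. e2ennreal (- log_dist (fst p) (snd p)) \<partial>?M)"
  define P where "P = (\<integral>\<^sup>+p. e2ennreal (log_dist (fst p) (snd p)) \<partial>?M)"
  define K where "K = (\<integral>\<^sup>+p. shifted_log_kernel (fst p) (snd p) \<partial>?M)"
  have const: "(\<integral>\<^sup>+p. ennreal c \<partial>?M) = ennreal c" for c
    by (simp add: P.emeasure_space_1)
  have "N + ennreal (ln 2) = (\<integral>\<^sup>+p. e2ennreal (- log_dist (fst p) (snd p)) + ennreal (ln 2) \<partial>?M)"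
    unfolding N_def by (subst nn_integral_add) (auto simp: const simp del: nn_integral_const)
  also have "\<dots> = (\<integral>\<^sup>+p. shifted_log_kernel (fst p) (snd p) + e2ennreal (log_dist (fst p) (snd p)) \<partial>?M)"
    using fst_snd_in_circle by (intro nn_integral_cong shifted_log_kernel_split) auto
  also have "\<dots> = K + P"
    unfolding K_def P_def by (rule nn_integral_add) auto
  finally have sum: "N + ennreal (ln 2) = K + P" .
  have "P \<le> (\<integral>\<^sup>+p. ennreal (ln 2) \<partial>?M)"
    unfolding P_def
  proof (rule nn_integral_mono)
    fix p assume "p \<in> space ?M"
    then have "fst p \<in> unit_circle" "snd p \<in> unit_circle"
      using fst_snd_in_circle by auto
    then show "e2ennreal (log_dist (fst p) (snd p)) \<le> ennreal (ln 2)"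
      using ln_norm_diff_le by (auto simp: log_dist_def e2ennreal_neg intro!: ennreal_leI)
  qed
  then have "P < \<infinity>"
    unfolding const by (simp add: order_le_less_trans)
  then obtain p where p: "P = ennreal p" "0 \<le> p"
    by (cases P) auto
  have "energy (\<lambda>_. 0) \<mu> = 0 - (enn2ereal P - enn2ereal N)"
    by (simp add: energy_def ereal_integral_def P_def N_def split_beta zero_ereal_def)
  also have "\<dots> = enn2ereal K - ereal (ln 2)"
  proof (cases N)
    case top
    then have "K = \<infinity>"
      using sum p by (cases K) (auto simp flip: ennreal_plus)
    then show ?thesis
      using top p by simp
  next
    case (real n)
    then have "ennreal (n + ln 2) = K + ennreal p"
      using sum p by simp
    then obtain k where k: "K = ennreal k" "0 \<le> k"
      by (cases K) auto
    with \<open>ennreal (n + ln 2) = K + ennreal p\<close> have "n + ln 2 = k + p"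
      using p real by (simp flip: ennreal_plus)
    then show ?thesis
      using k p real by (simp add: zero_ereal_def)
  qed
  finally show ?thesis
    by (simp add: K_def)
qed

definition moment :: "nat \<Rightarrow> complex"
  where "moment k = (\<integral>z. z ^ k \<partial>\<mu>)"

lemma measurable_power: "(\<lambda>z. z ^ k) \<in> borel_measurable \<mu>"
  by (intro measurable_borel_circle) measurable

text \<open>The variables separate, so Fubini produces \<open>moment k\<close> times its conjugate.
  For \<open>k = 0\<close> both sides vanish by division by zero.\<close>

lemma integral_power_product:
  "(\<integral>p. Re ((of_real r * (fst p * cnj (snd p))) ^ k / of_nat k) \<partial>(\<mu> \<Otimes>\<^sub>M \<mu>)) =
    r ^ k / of_nat k * (cmod (moment k))\<^sup>2"
proof -
  let ?f = "\<lambda>p. (of_real r * (fst p * cnj (snd p))) ^ k / of_nat k"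
  have int: "integrable (\<mu> \<Otimes>\<^sub>M \<mu>) ?f"
    using fst_snd_in_circle
    by (intro P.integrable_const_bound[where B = "\<bar>r\<bar> ^ k / of_nat k"] AE_I2)
       (auto simp: norm_divide norm_power norm_mult)
  have "(\<integral>p. ?f p \<partial>(\<mu> \<Otimes>\<^sub>M \<mu>)) = (\<integral>x. (\<integral>y. ?f (x, y) \<partial>\<mu>) \<partial>\<mu>)"
    using int by (rule integral_fst'[symmetric])
  also have "\<dots> = (\<integral>x. (\<integral>y. of_real (r ^ k / of_nat k) * x ^ k * cnj (y ^ k) \<partial>\<mu>) \<partial>\<mu>)"
    by (simp add: power_mult_distrib field_simps)
  also have "\<dots> = (\<integral>x. of_real (r ^ k / of_nat k) * cnj (moment k) * x ^ k \<partial>\<mu>)"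
  proof -
    have "(\<integral>y. of_real (r ^ k / of_nat k) * x ^ k * cnj (y ^ k) \<partial>\<mu>) =
        of_real (r ^ k / of_nat k) * cnj (moment k) * x ^ k" for x
      by (simp only: integral_mult_right_zero Bochner_Integration.integral_cnj moment_def) (simp only: mult_ac)
    then show ?thesis by (simp only:)
  qed
  also have "\<dots> = of_real (r ^ k / of_nat k) * cnj (moment k) * moment k"
    by (simp only: integral_mult_right_zero moment_def)
  also have "\<dots> = of_real (r ^ k / of_nat k * (cmod (moment k))\<^sup>2)"
    by (simp only: of_real_mult complex_norm_square mult_ac)
  finally show ?thesis
    by (simp only: integral_Re[OF int] Re_complex_of_real)
qed

text \<open>On the circle the \<open>k\<close>-th term of the series is at most
  \<open>r ^ k\<close>, and this geometric majorant permits termwise integration.\<close>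

lemma log_potential_integral:
  assumes r: "0 \<le> r" "r < 1"
  shows "integrable (\<mu> \<Otimes>\<^sub>M \<mu>) (\<lambda>p. log_potential r (fst p) (snd p))"
    and "(\<lambda>k. r ^ k / of_nat k * (cmod (moment k))\<^sup>2) sums
      (\<integral>p. log_potential r (fst p) (snd p) \<partial>(\<mu> \<Otimes>\<^sub>M \<mu>))"
proof -
  let ?M = "\<mu> \<Otimes>\<^sub>M \<mu>"
  let ?f = "\<lambda>k p. Re ((of_real r * (fst p * cnj (snd p))) ^ k / of_nat k)"
  have bound: "norm (?f k p) \<le> r ^ k" if "p \<in> space ?M" for k p
  proof -
    have "norm (?f k p) \<le> norm ((of_real r * (fst p * cnj (snd p))) ^ k / of_nat k)"
      unfolding real_norm_def by (rule abs_Re_le_cmod)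
    also have "\<dots> = r ^ k / of_nat k"
      using fst_snd_in_circle[OF that] r by (simp add: norm_divide norm_power norm_mult)
    also have "\<dots> \<le> r ^ k"
      using r by (cases "k = 0") (auto simp: divide_le_eq mult_le_cancel_left1)
    finally show ?thesis .
  qed
  have int: "integrable ?M (?f k)" for k
    using bound by (intro P.integrable_const_bound[where B = "r ^ k"] AE_I2) auto
  have "(\<integral>p. norm (?f k p) \<partial>?M) \<le> (\<integral>p. r ^ k \<partial>?M)" for k
    using bound int by (intro integral_mono integrable_norm) auto
  then have "(\<integral>p. norm (?f k p) \<partial>?M) \<le> r ^ k" for k
    by (simp add: P.prob_space)
  then have sums: "summable (\<lambda>k. \<integral>p. norm (?f k p) \<partial>?M)"
    using r by (intro summable_comparison_test'[OF summable_geometric[of r]]) auto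
  have summable: "AE p in ?M. summable (\<lambda>k. norm (?f k p))"
    using bound r by (intro AE_I2 summable_comparison_test'[OF summable_geometric[of r]]) auto
  have eq: "(\<Sum>k. ?f k p) = log_potential r (fst p) (snd p)" if "p \<in> space ?M" for p
    using fst_snd_in_circle[OF that] r by (intro sums_unique[symmetric] log_potential_sums) auto
  show "integrable ?M (\<lambda>p. log_potential r (fst p) (snd p))"
    using integrable_suminf[OF int summable sums] eq by (simp cong: Bochner_Integration.integrable_cong)
  show "(\<lambda>k. r ^ k / of_nat k * (cmod (moment k))\<^sup>2) sums
      (\<integral>p. log_potential r (fst p) (snd p) \<partial>?M)"
    using sums_integral[OF int summable sums] eq
    by (simp only: integral_power_product cong: Bochner_Integration.integral_cong)
qed

lemma nn_integral_log_potential: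
  assumes r: "0 \<le> r" "r < 1"
  shows "(\<integral>\<^sup>+p. ennreal (ln 2 + log_potential r (fst p) (snd p)) \<partial>(\<mu> \<Otimes>\<^sub>M \<mu>)) =
    ennreal (ln 2 + (\<Sum>k. r ^ k / of_nat k * (cmod (moment k))\<^sup>2))"
proof -
  have "(\<integral>\<^sup>+p. ennreal (ln 2 + log_potential r (fst p) (snd p)) \<partial>(\<mu> \<Otimes>\<^sub>M \<mu>)) =
      ennreal (\<integral>p. ln 2 + log_potential r (fst p) (snd p) \<partial>(\<mu> \<Otimes>\<^sub>M \<mu>))"
    using log_potential_integral(1)[OF r] log_potential_ge[OF _ _ r] fst_snd_in_circle
    by (intro nn_integral_eq_integral AE_I2) auto
  also have "(\<integral>p. ln 2 + log_potential r (fst p) (snd p) \<partial>(\<mu> \<Otimes>\<^sub>M \<mu>)) =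
      ln 2 + (\<integral>p. log_potential r (fst p) (snd p) \<partial>(\<mu> \<Otimes>\<^sub>M \<mu>))"
    using log_potential_integral(1)[OF r]
    by (subst Bochner_Integration.integral_add) (auto simp: P.prob_space)
  finally show ?thesis
    using sums_unique[OF log_potential_integral(2)[OF r]] by simp
qed

text \<open>The regularised energy is a series of nonnegative terms, and the regularised kernel
  exceeds the true one by at most \<open>- ln r / 2\<close>, which is arbitrarily small.\<close>

lemma energy_nonneg: "0 \<le> energy (\<lambda>_. 0) \<mu>"
proof -
  let ?M = "\<mu> \<Otimes>\<^sub>M \<mu>"
  let ?K = "\<integral>\<^sup>+p. shifted_log_kernel (fst p) (snd p) \<partial>?M"
  have "ennreal (ln 2) \<le> ?K"
  proof (rule ennreal_le_epsilon)
    fix e :: real assume e: "0 < e"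
    \<comment> \<open>Chosen so that the loss \<open>- ln r / 2\<close> is exactly
      \<open>e\<close>.\<close>
    define r where "r = exp (- 2 * e)"
    have r: "0 < r" "r < 1" "- ln r / 2 = e"
      using e by (simp_all add: r_def)
    have "0 \<le> (\<Sum>k. r ^ k / of_nat k * (cmod (moment k))\<^sup>2)"
      using r sums_summable[OF log_potential_integral(2)[of r]] by (intro suminf_nonneg) auto
    then have "ennreal (ln 2) \<le> ennreal (ln 2 + (\<Sum>k. r ^ k / of_nat k * (cmod (moment k))\<^sup>2))"
      by (intro ennreal_leI) simp
    also have "\<dots> = (\<integral>\<^sup>+p. ennreal (ln 2 + log_potential r (fst p) (snd p)) \<partial>?M)"
      using r by (intro nn_integral_log_potential[symmetric]) auto
    also have "\<dots> \<le> (\<integral>\<^sup>+p. shifted_log_kernel (fst p) (snd p) + ennreal e \<partial>?M)"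
      using fst_snd_in_circle shifted_log_kernel_ge[OF _ _ r(1,2)] r(3)
      by (intro nn_integral_mono) auto
    also have "\<dots> = ?K + ennreal e"
      by (subst nn_integral_add) (auto simp: P.emeasure_space_1)
    finally show "ennreal (ln 2) \<le> ?K + ennreal e" .
  qed
  then have "ereal (ln 2) \<le> enn2ereal ?K"
    by (cases ?K) (auto simp: ennreal_le_iff)
  then show ?thesis
    unfolding energy_eq_shifted by (cases "enn2ereal ?K") auto
qed

text \<open>Since \<open>r ^ k \<le> 1\<close> and \<open>1 / k \<le> 1\<close>, every regularised
  energy is at most \<open>b\<close>; Fatou's lemma carries the bound to the true kernel.\<close>

lemma energy_le:
  assumes b: "\<And>n. (\<Sum>k=1..<n. (cmod (moment k))\<^sup>2) \<le> b"
  shows "energy (\<lambda>_. 0) \<mu> \<le> ereal b"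
proof -
  let ?M = "\<mu> \<Otimes>\<^sub>M \<mu>"
  let ?K = "\<integral>\<^sup>+p. shifted_log_kernel (fst p) (snd p) \<partial>?M"
  let ?r = "\<lambda>n. 1 - 1 / real (n + 2)"
  have b0: "0 \<le> b"
    using b[of 0] by simp
  have r: "0 \<le> ?r n" "?r n < 1" for n
    by (simp_all add: field_simps)
  have le: "(\<Sum>k. ?r n ^ k / of_nat k * (cmod (moment k))\<^sup>2) \<le> b" for n
  proof (rule suminf_le_const[OF sums_summable[OF log_potential_integral(2)[OF r]]])
    fix N
    \<comment> \<open>The moment of order \<open>0\<close>, which equals \<open>1\<close>, drops out
      because its coefficient \<open>1 / 0\<close> is \<open>0\<close>.\<close>
    have "(\<Sum>k<N. ?r n ^ k / of_nat k * (cmod (moment k))\<^sup>2) =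
        (\<Sum>k=1..<N. ?r n ^ k / of_nat k * (cmod (moment k))\<^sup>2)"
      by (rule sum.mono_neutral_right) (auto simp: not_less_eq_eq)
    also have "\<dots> \<le> (\<Sum>k=1..<N. (cmod (moment k))\<^sup>2)"
    proof (rule sum_mono)
      fix k assume k: "k \<in> {1..<N}"
      have "?r n ^ k \<le> 1"
        using r[of n] by (intro power_le_one) auto
      then have "?r n ^ k / of_nat k \<le> 1"
        using k by (simp add: divide_le_eq)
      then show "?r n ^ k / of_nat k * (cmod (moment k))\<^sup>2 \<le> (cmod (moment k))\<^sup>2"
        by (rule mult_left_le_one_le[rotated 2]) (use r in auto)
    qed
    also have "\<dots> \<le> b" by (rule b)
    finally show "(\<Sum>k<N. ?r n ^ k / of_nat k * (cmod (moment k))\<^sup>2) \<le> b" .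
  qed
  have "?K = (\<integral>\<^sup>+p. liminf (\<lambda>n. ennreal (ln 2 + log_potential (?r n) (fst p) (snd p))) \<partial>?M)"
    using fst_snd_in_circle log_potential_tendsto
    by (intro nn_integral_cong lim_imp_Liminf[symmetric]) auto
  also have "\<dots> \<le> liminf (\<lambda>n. \<integral>\<^sup>+p. ennreal (ln 2 + log_potential (?r n) (fst p) (snd p)) \<partial>?M)"
    by (intro nn_integral_liminf) measurable
  also have "\<dots> = liminf (\<lambda>n. ennreal (ln 2 + (\<Sum>k. ?r n ^ k / of_nat k * (cmod (moment k))\<^sup>2)))"
    by (simp only: nn_integral_log_potential[OF r])
  also have "\<dots> \<le> liminf (\<lambda>n. ennreal (ln 2 + b))"
    using le by (intro Liminf_mono always_eventually allI ennreal_leI) simp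
  also have "\<dots> = ennreal (ln 2 + b)"
    by (simp add: Liminf_const)
  finally have "?K \<le> ennreal (ln 2 + b)" .
  then have "enn2ereal ?K \<le> ereal (ln 2 + b)"
    using b0 by (cases ?K) (auto simp: ennreal_le_iff top_unique simp del: ennreal_plus)
  then show ?thesis
    unfolding energy_eq_shifted using b0 by (cases "enn2ereal ?K") auto
qed

end

subsection \<open>Comparison of energy and Fisher information\<close>

text \<open>For \<open>k \<le> j\<close> the integrand is \<open>cis t ^ (j - k)\<close>, whose mean
  is the value of a monomial at \<open>0\<close>; conjugation gives the other case.\<close>

lemma integral_cis_power_mult_cnj:
  "(\<integral>t. cis t ^ j * cnj (cis t ^ k) \<partial>angle_measure) = (if j = k then 1 else 0)"
proof -
  have mean: "(\<integral>t. cis t ^ n \<partial>angle_measure) = (if n = 0 then 1 else 0)" for n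
  proof -
    have "(\<lambda>z. z ^ n) holomorphic_on ball 0 2"
      by (intro holomorphic_intros)
    from circle_mean_value[OF this, of 1] show ?thesis
      by (simp add: power_0_left)
  qed
  have le: "(\<integral>t. cis t ^ j * cnj (cis t ^ k) \<partial>angle_measure) = (if j = k then 1 else 0)" if "k \<le> j" for j k
  proof -
    have "cis t ^ j * cnj (cis t ^ k) = cis t ^ (j - k)" for t
    proof -
      have "cis t ^ j * cnj (cis t ^ k) = cis t ^ (j - k) * (cis t ^ k * cnj (cis t ^ k))"
        using that by (simp flip: power_add mult.assoc)
      also have "cis t ^ k * cnj (cis t ^ k) = 1"
        by (simp only: complex_norm_square[symmetric]) (simp add: norm_power)
      finally show ?thesis by simp
    qed
    then show ?thesis
      using that mean[of "j - k"] by auto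
  qed
  show ?thesis
  proof (cases "k \<le> j")
    case False
    have "(\<integral>t. cis t ^ j * cnj (cis t ^ k) \<partial>angle_measure) =
        cnj (\<integral>t. cis t ^ k * cnj (cis t ^ j) \<partial>angle_measure)"
      by (subst Bochner_Integration.integral_cnj[symmetric]) (simp add: mult.commute)
    then show ?thesis
      using le[of j k] False by auto
  qed (rule le)
qed

text \<open>The factor \<open>1 / 2\<close> reflects that \<open>u\<close> is real: frequencies
  \<open>k\<close> and \<open>-k\<close> contribute equally. The function \<open>2 Re V\<close> is
  the orthogonal projection of \<open>u\<close> onto the frequencies of modulus between
  \<open>1\<close> and \<open>n - 1\<close>, and the claim is that the squared distance to it is
  nonnegative.\<close>

lemma bessel_angle_measure:
  fixes u :: "real \<Rightarrow> real"
  assumes u: "continuous_on UNIV u"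
  defines "c \<equiv> \<lambda>k. \<integral>t. of_real (u t) * cis t ^ k \<partial>angle_measure"
  shows "(\<Sum>k=1..<n. (cmod (c k))\<^sup>2) \<le> (\<integral>t. (u t)\<^sup>2 \<partial>angle_measure) / 2"
proof -
  define V where "V z = (\<Sum>k=1..<n. cnj (c k) * z ^ k)" for z
  define S where "S = (\<Sum>k=1..<n. (cmod (c k))\<^sup>2)"
  note int = integrable_angle_measure_continuous
  have contV: "continuous_on UNIV (\<lambda>t. V (cis t))"
    unfolding V_def by (intro continuous_intros)
  have "(\<integral>t. of_real (u t) * V (cis t) \<partial>angle_measure) =
      (\<Sum>k=1..<n. \<integral>t. cnj (c k) * (of_real (u t) * cis t ^ k) \<partial>angle_measure)"
    unfolding V_def sum_distrib_left
    by (subst Bochner_Integration.integral_sum[symmetric])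
       (auto intro!: int continuous_intros u simp: mult_ac)
  also have "\<dots> = (\<Sum>k=1..<n. cnj (c k) * c k)"
    by (simp add: c_def)
  also have "\<dots> = of_real S"
    unfolding S_def of_real_sum complex_norm_square by (simp only: mult.commute)
  finally have uV: "(\<integral>t. of_real (u t) * V (cis t) \<partial>angle_measure) = of_real S" .
  \<comment> \<open>\<open>V\<close> has no constant term, so the mean of \<open>V ^ 2\<close> is
    \<open>0\<close>.\<close>
  have "(\<integral>t. V (of_real 1 * cis t) ^ 2 \<partial>angle_measure) = V 0 ^ 2"
    unfolding V_def by (rule circle_mean_value[where R = 2]) (auto intro!: holomorphic_intros)
  then have VV: "(\<integral>t. V (cis t) ^ 2 \<partial>angle_measure) = 0"
    by (simp add: V_def power_0_left)
  have "(\<integral>t. V (cis t) * cnj (V (cis t)) \<partial>angle_measure) =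
      (\<integral>t. (\<Sum>j=1..<n. \<Sum>k=1..<n. cnj (c j) * c k * (cis t ^ j * cnj (cis t ^ k))) \<partial>angle_measure)"
    unfolding V_def cnj_sum sum_product by (simp add: mult_ac)
  also have "\<dots> = (\<Sum>j=1..<n. \<Sum>k=1..<n. cnj (c j) * c k * (\<integral>t. cis t ^ j * cnj (cis t ^ k) \<partial>angle_measure))"
  proof -
    have "(\<integral>t. (\<Sum>k=1..<n. cnj (c j) * c k * (cis t ^ j * cnj (cis t ^ k))) \<partial>angle_measure) =
        (\<Sum>k=1..<n. cnj (c j) * c k * (\<integral>t. cis t ^ j * cnj (cis t ^ k) \<partial>angle_measure))" for j
      by (subst Bochner_Integration.integral_sum)
         (intro int continuous_intros, simp only: integral_mult_right_zero)
    then show ?thesis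
      by (subst Bochner_Integration.integral_sum) (intro int continuous_intros, simp only:)
  qed
  also have "\<dots> = (\<Sum>j=1..<n. cnj (c j) * c j)"
    unfolding integral_cis_power_mult_cnj by (simp add: if_distrib[of "(*) _"] cong: if_cong)
  also have "\<dots> = of_real S"
    unfolding S_def of_real_sum complex_norm_square by (simp only: mult.commute)
  finally have VcV: "(\<integral>t. V (cis t) * cnj (V (cis t)) \<partial>angle_measure) = of_real S" .
  have i1: "integrable angle_measure (\<lambda>t. (u t)\<^sup>2)"
    and i2: "integrable angle_measure (\<lambda>t. of_real (u t) * V (cis t))"
    and i3: "integrable angle_measure (\<lambda>t. V (cis t) ^ 2)"
    and i4: "integrable angle_measure (\<lambda>t. V (cis t) * cnj (V (cis t)))"
    by (intro int continuous_intros u contV)+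
  \<comment> \<open>From \<open>4 (Re v)^2 = 2 Re (v^2) + 2 |v|^2\<close>. After integration the
    terms contribute \<open>- 4 S\<close>, \<open>0\<close> and \<open>2 S\<close>.\<close>
  have expand: "(u t - 2 * Re (V (cis t)))\<^sup>2 = (u t)\<^sup>2 - 4 * Re (of_real (u t) * V (cis t))
      + 2 * Re (V (cis t) ^ 2) + 2 * Re (V (cis t) * cnj (V (cis t)))" for t
    by (simp add: power2_eq_square algebra_simps)
  have "0 \<le> (\<integral>t. (u t - 2 * Re (V (cis t)))\<^sup>2 \<partial>angle_measure)"
    by (rule Bochner_Integration.integral_nonneg) simp
  also have "\<dots> = (\<integral>t. (u t)\<^sup>2 \<partial>angle_measure) - 4 * Re (\<integral>t. of_real (u t) * V (cis t) \<partial>angle_measure)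
      + 2 * Re (\<integral>t. V (cis t) ^ 2 \<partial>angle_measure) + 2 * Re (\<integral>t. V (cis t) * cnj (V (cis t)) \<partial>angle_measure)"
    unfolding expand integral_Re[OF i2, symmetric] integral_Re[OF i3, symmetric] integral_Re[OF i4, symmetric]
    using i1 integrable_Re[OF i2] integrable_Re[OF i3] integrable_Re[OF i4]
    by (simp only: Bochner_Integration.integral_add Bochner_Integration.integral_diff
        integral_mult_right_zero integrable_mult_right Bochner_Integration.integrable_add
        Bochner_Integration.integrable_diff)
  also have "\<dots> = (\<integral>t. (u t)\<^sup>2 \<partial>angle_measure) - 2 * S"
    by (simp only: uV VV VcV) simp
  finally show ?thesis
    by (simp add: S_def)
qed

context smooth_circle_measure
begin

sublocale circle_probability \<mu>
  by unfold_locales (rule prob)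

text \<open>For \<open>k \<ge> 1\<close> the powers of \<open>cis\<close> have mean zero, so
  \<open>m\<close> and \<open>m - 1\<close> have the same moments, and Bessel is applied to
  \<open>m - 1\<close>.\<close>

lemma energy_le_variance:
  "energy (\<lambda>_. 0) \<mu> \<le> ereal ((\<integral>x. (m (cis x) - 1)\<^sup>2 \<partial>angle_measure) / 2)"
proof (rule energy_le)
  fix n
  have "moment k = (\<integral>t. of_real (m (cis t) - 1) * cis t ^ k \<partial>angle_measure)" if "k \<in> {1..<n}" for k
  proof -
    have "(\<lambda>z. z ^ k) \<in> borel_measurable circle_haar"
      using measurable_power[of k] by (simp cong: measurable_cong_sets add: sets_circle_haar sets_eq)
    then have "moment k = (\<integral>t. of_real (m (cis t)) * cis t ^ k \<partial>angle_measure)"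
      unfolding moment_def by (subst integral_smooth) (auto simp: scaleR_conv_of_real)
    also have "\<dots> = (\<integral>t. of_real (m (cis t)) * cis t ^ k \<partial>angle_measure) - (\<integral>t. cis t ^ k \<partial>angle_measure)"
      using integral_cis_power_mult_cnj[of k 0] that by auto
    also have "\<dots> = (\<integral>t. of_real (m (cis t)) * cis t ^ k - cis t ^ k \<partial>angle_measure)"
      by (intro Bochner_Integration.integral_diff[symmetric] integrable_angle_measure_continuous continuous_intros)
    finally show ?thesis
      by (simp add: algebra_simps)
  qed
  moreover have "(\<Sum>k=1..<n. (cmod (\<integral>t. of_real (m (cis t) - 1) * cis t ^ k \<partial>angle_measure))\<^sup>2)
      \<le> (\<integral>x. (m (cis x) - 1)\<^sup>2 \<partial>angle_measure) / 2"
    by (intro bessel_angle_measure continuous_intros)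
  ultimately show "(\<Sum>k=1..<n. (cmod (moment k))\<^sup>2) \<le> (\<integral>x. (m (cis x) - 1)\<^sup>2 \<partial>angle_measure) / 2"
    by simp
qed

text \<open>As \<open>m\<close> has mean \<open>1\<close>, integrating \<open>m (m - 1)^2\<close>
  gives that twice the integral of \<open>m^2\<close> is at most the integral of \<open>m^3\<close>
  plus \<open>1\<close>.\<close>

lemma variance_le_cube:
  "(\<integral>x. (m (cis x) - 1)\<^sup>2 \<partial>angle_measure) / 2 \<le> ((\<integral>x. (m (cis x))^3 \<partial>angle_measure) - 1) / 4"
proof -
  interpret A: prob_space angle_measure by (rule prob_space_angle_measure)
  have i: "integrable angle_measure (\<lambda>x. m (cis x) ^ k)" for k
    by (intro integrable_angle_measure_continuous continuous_intros)
  have i1: "integrable angle_measure (\<lambda>x. m (cis x))"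
    using i[of 1] by simp
  have eq: "(\<integral>x. (m (cis x) - 1)\<^sup>2 \<partial>angle_measure) = (\<integral>x. (m (cis x))\<^sup>2 \<partial>angle_measure) - 1"
    using i[of 2] i1
    by (simp add: power2_diff integral_density_eq_1 A.prob_space)
  have "0 \<le> (\<integral>x. m (cis x) * (m (cis x) - 1)\<^sup>2 \<partial>angle_measure)"
    using nonneg by (intro Bochner_Integration.integral_nonneg) auto
  also have "\<dots> = (\<integral>x. (m (cis x))^3 - 2 * (m (cis x))\<^sup>2 + m (cis x) \<partial>angle_measure)"
    by (simp add: power2_eq_square power3_eq_cube algebra_simps)
  also have "\<dots> = (\<integral>x. (m (cis x))^3 \<partial>angle_measure) - 2 * (\<integral>x. (m (cis x))\<^sup>2 \<partial>angle_measure) + 1"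
    using i[of 2] i[of 3] i1 by (simp add: integral_density_eq_1)
  finally show ?thesis
    unfolding eq by simp
qed

end

lemma smooth_circle_measure_circle_haar: "smooth_circle_measure circle_haar (\<lambda>_. 1) 0"
proof
  show "circle_prob_measure circle_haar"
    by (simp add: circle_prob_measure_def prob_space_circle_haar sets_circle_haar)
qed (auto simp: density_1 intro: periodic_lipschitz.intro)

text \<open>A value of \<open>arg_min\<close> can be reasoned about only after a minimizer is
  exhibited. Haar measure is one: its density \<open>1\<close> has variance \<open>0\<close>, so its
  energy is at most \<open>0\<close>, and no energy is negative.\<close>

lemma circle_prob_measure_equilibrium: "circle_prob_measure (equilibrium_measure (\<lambda>_. 0))"
proof -
  interpret H: smooth_circle_measure circle_haar "\<lambda>_. 1" 0
    by (rule smooth_circle_measure_circle_haar)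
  have "energy (\<lambda>_. 0) circle_haar \<le> 0"
    using H.energy_le_variance by (simp add: zero_ereal_def)
  moreover have "0 \<le> energy (\<lambda>_. 0) \<nu>" if "circle_prob_measure \<nu>" for \<nu>
    using that by (intro circle_probability.energy_nonneg circle_probability.intro)
  ultimately have "is_arg_min (energy (\<lambda>_. 0)) circle_prob_measure circle_haar"
    unfolding is_arg_min_def using H.prob by (meson not_less order_trans)
  then have "is_arg_min (energy (\<lambda>_. 0)) circle_prob_measure (equilibrium_measure (\<lambda>_. 0))"
    unfolding equilibrium_measure_def arg_min_def by (rule someI)
  then show ?thesis
    by (simp add: is_arg_min_def)
qed

theorem proposition7:
  shows "\<exists>\<delta>::real. \<delta> > 0 \<and> LSI ((1 + \<delta>) / 4) (\<lambda>_. 0)"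
proof (intro exI conjI)
  \<comment> \<open>With \<open>C\<close> the integral of \<open>m^3\<close>, the energy is at most
    \<open>(C - 1) / 4\<close> and the Fisher information equals \<open>(C - 1) / 3\<close>; the
    ratio \<open>3 / 4\<close> is \<open>1 / (1 + 1 / 3)\<close>.\<close>
  show "LSI ((1 + 1 / 3) / 4) (\<lambda>_. 0)"
    unfolding LSI_def
  proof (intro allI impI)
    fix \<mu> assume \<mu>: "smooth_prob_measure \<mu>"
    have d: "is_smooth_density \<mu> (smooth_density \<mu>)"
      using \<mu> by (rule smooth_density_props)
    then have smooth: "smooth_on_circle (smooth_density \<mu>)"
      by (simp add: is_smooth_density_def)
    then obtain L where "periodic_lipschitz (\<lambda>x. smooth_density \<mu> (cis x)) L"
      using smooth_on_circle_periodic_lipschitz by blast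
    then have loc: "smooth_circle_measure \<mu> (smooth_density \<mu>) L"
      using d \<mu> by (auto simp: smooth_circle_measure_def is_smooth_density_def smooth_prob_measure_def)
    interpret smooth_circle_measure \<mu> "smooth_density \<mu>" L by (rule loc)
    have "0 \<le> energy (\<lambda>_. 0) (equilibrium_measure (\<lambda>_. 0))"
      by (intro circle_probability.energy_nonneg circle_probability.intro circle_prob_measure_equilibrium)
    then have "energy (\<lambda>_. 0) \<mu> - energy (\<lambda>_. 0) (equilibrium_measure (\<lambda>_. 0)) \<le> energy (\<lambda>_. 0) \<mu>"
      using ereal_minus_mono[OF order_refl] by fastforce
    also have "\<dots> \<le> ereal ((\<integral>x. (smooth_density \<mu> (cis x) - 1)\<^sup>2 \<partial>angle_measure) / 2)"
      by (rule energy_le_variance)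
    also have "\<dots> \<le> ereal (((\<integral>x. (smooth_density \<mu> (cis x))^3 \<partial>angle_measure) - 1) / 4)"
      using variance_le_cube by simp
    also have "((\<integral>x. (smooth_density \<mu> (cis x))^3 \<partial>angle_measure) - 1) / 4 =
        1 / (4 * ((1 + 1 / 3) / 4)) * fisher_information (\<lambda>_. 0) \<mu>"
      using fisher_information_zero[OF loc smooth] by simp
    finally show "energy (\<lambda>_. 0) \<mu> - energy (\<lambda>_. 0) (equilibrium_measure (\<lambda>_. 0))
        \<le> ereal (1 / (4 * ((1 + 1 / 3) / 4)) * fisher_information (\<lambda>_. 0) \<mu>)" .
  qed
qed simp

end
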